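(* Let $p$ be a prime and let $G$ be a finite $p$-group with an abelian maximal subgroup. Then $G$ is self-similar if and only if $G$ possesses an elementary abelian maximal subgroup over which $G$ splits.
   Context: The $p$-adic tree $\mathcal{T}$ is the rooted tree whose vertices are the words of the free monoid $X^*$ on a set $X$ with $|X|=p$, where the children of $u\in X^*$ are the words $ux$, $x\in X$. $\operatorname{Aut}\mathcal{T}$ is the group of bijections of $X^*$ preserving incidence (hence fixing the root and preserving levels). For $g\in\operatorname{Aut}\mathcal{T}$ and $u\in X^*$, the section $g_u\in\operatorname{Aut}\mathcal{T}$ is defined by $g(uv)=g(u)g_u(v)$ for all $v\in X^*$. A subgroup $G\le \operatorname{Aut}\mathcal{T}$ is self-similar if $g_u\in G$ for all $g\in G$ and all $u\in X^*$. A finite $p$-group $G$ is called self-similar if it is isomorphic to a self-similar subgroup of $\operatorname{Aut}\mathcal{T}$, where $\mathcal{T}$ is the $p$-adic tree (same prime $p$). $G$ splits over a normal subgroup $M$ if $M$ has a complement in $G$. The trivial group counts as elementary abelian. *)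

theory Defs
  imports "HOL-Algebra.Bij" "HOL-Algebra.Coset" "HOL-Computational_Algebra.Primes"
begin

text \<open>
  The rooted tree on the free monoid over \<open>X\<close> has vertex set \<^term>\<open>lists X\<close> and root
  \<^term>\<open>[]\<close>. As in \<^const>\<open>Bij\<close>, its automorphisms are extensional functions, so that equality
  of automorphisms is equality of functions.
\<close>

definition tree_adj :: "'x set \<Rightarrow> 'x list \<Rightarrow> 'x list \<Rightarrow> bool" where
  "tree_adj X u v \<longleftrightarrow> (\<exists>x\<in>X. v = u @ [x] \<or> u = v @ [x])"

definition tree_auts :: "'x set \<Rightarrow> ('x list \<Rightarrow> 'x list) set" where
  "tree_auts X = {g \<in> Bij (lists X).
     \<forall>u\<in>lists X. \<forall>v\<in>lists X. tree_adj X (g u) (g v) \<longleftrightarrow> tree_adj X u v}"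

definition Aut_tree :: "'x set \<Rightarrow> ('x list \<Rightarrow> 'x list) monoid" where
  "Aut_tree X = (BijGroup (lists X))\<lparr>carrier := tree_auts X\<rparr>"

text \<open>For finite \<open>X\<close> the section exists and is unique: see \<open>tree_section_ex1\<close> below.\<close>

definition tree_section ::
  "'x set \<Rightarrow> ('x list \<Rightarrow> 'x list) \<Rightarrow> 'x list \<Rightarrow> 'x list \<Rightarrow> 'x list" where
  "tree_section X g u = (THE h. h \<in> tree_auts X \<and> (\<forall>v\<in>lists X. g (u @ v) = g u @ h v))"

definition self_similar_subgroup :: "'x set \<Rightarrow> ('x list \<Rightarrow> 'x list) set \<Rightarrow> bool" where
  "self_similar_subgroup X H \<longleftrightarrow>
     subgroup H (Aut_tree X) \<and> (\<forall>g\<in>H. \<forall>u\<in>lists X. tree_section X g u \<in> H)"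

definition self_similar :: "'x set \<Rightarrow> ('a, 'b) monoid_scheme \<Rightarrow> bool" where
  "self_similar X G \<longleftrightarrow>
     (\<exists>H. self_similar_subgroup X H \<and> G \<cong> (Aut_tree X)\<lparr>carrier := H\<rparr>)"

definition finite_p_group :: "nat \<Rightarrow> ('a, 'b) monoid_scheme \<Rightarrow> bool" where
  "finite_p_group p G \<longleftrightarrow> group G \<and> finite (carrier G) \<and> (\<exists>n. order G = p ^ n)"

definition maximal_subgroup :: "'a set \<Rightarrow> ('a, 'b) monoid_scheme \<Rightarrow> bool" where
  "maximal_subgroup M G \<longleftrightarrow> subgroup M G \<and> M \<noteq> carrier G \<and>
     (\<forall>K. subgroup K G \<longrightarrow> M \<subseteq> K \<longrightarrow> K = M \<or> K = carrier G)"

definition elementary_abelian :: "nat \<Rightarrow> ('a, 'b) monoid_scheme \<Rightarrow> bool" where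
  "elementary_abelian p G \<longleftrightarrow> comm_group G \<and> (\<forall>x\<in>carrier G. x [^]\<^bsub>G\<^esub> p = \<one>\<^bsub>G\<^esub>)"

definition splits_over :: "('a, 'b) monoid_scheme \<Rightarrow> 'a set \<Rightarrow> bool" where
  "splits_over G M \<longleftrightarrow> M \<lhd> G \<and>
     (\<exists>K. subgroup K G \<and> M \<inter> K = {\<one>\<^bsub>G\<^esub>} \<and> M <#>\<^bsub>G\<^esub> K = carrier G)"

subsection \<open>Well-definedness\<close>

lemma tree_auts_inv:
  assumes g: "g \<in> tree_auts X"
  shows "(\<lambda>v\<in>lists X. inv_into (lists X) g v) \<in> tree_auts X"
proof -
  have b: "bij_betw g (lists X) (lists X)" using g by (auto simp: tree_auts_def Bij_def)
  have i: "inv_into (lists X) g v \<in> lists X" "g (inv_into (lists X) g v) = v"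
    if "v \<in> lists X" for v
    using b that by (auto simp: bij_betw_def inv_into_into f_inv_into_f)
  show ?thesis
    using g i unfolding tree_auts_def
    by (simp add: restrict_inv_into_Bij) metis
qed

lemma group_Aut_tree: "group (Aut_tree X)"
proof -
  interpret B: group "BijGroup (lists X)" by (rule group_BijGroup)
  have "subgroup (tree_auts X) (BijGroup (lists X))"
  proof (rule B.subgroupI)
    show "tree_auts X \<subseteq> carrier (BijGroup (lists X))"
      by (auto simp: tree_auts_def BijGroup_def)
    have "(\<lambda>v\<in>lists X. v) \<in> tree_auts X"
      by (simp add: tree_auts_def id_Bij)
    then show "tree_auts X \<noteq> {}" by blast
  next
    fix g assume "g \<in> tree_auts X"
    then show "inv\<^bsub>BijGroup (lists X)\<^esub> g \<in> tree_auts X"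
      using tree_auts_inv[of g X] inv_BijGroup[of g "lists X"] by (simp add: tree_auts_def)
  next
    fix g h assume "g \<in> tree_auts X" "h \<in> tree_auts X"
    then show "g \<otimes>\<^bsub>BijGroup (lists X)\<^esub> h \<in> tree_auts X"
      unfolding tree_auts_def
      by (simp add: BijGroup_def compose_Bij compose_eq Bij_imp_funcset[THEN funcset_mem])
  qed
  then show ?thesis unfolding Aut_tree_def by (rule B.subgroup_imp_group)
qed

lemma tree_auts_Nil:
  assumes "finite X" and g: "g \<in> tree_auts X"
  shows "g [] = []"
proof (rule ccontr)
  assume ne: "g [] \<noteq> []"
  have b: "bij_betw g (lists X) (lists X)" using g by (auto simp: tree_auts_def Bij_def)
  have adj: "tree_adj X (g u) (g v) \<longleftrightarrow> tree_adj X u v" if "u \<in> lists X" "v \<in> lists X" for u v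
    using g that by (auto simp: tree_auts_def)
  define N where "N u = {v \<in> lists X. tree_adj X u v}" for u
  have gN: "g ` N [] = N (g [])"
  proof
    show "g ` N [] \<subseteq> N (g [])" using b adj by (auto simp: N_def bij_betw_def)
    show "N (g []) \<subseteq> g ` N []"
    proof
      fix w assume w: "w \<in> N (g [])"
      then have "w \<in> g ` lists X" using b by (simp add: N_def bij_betw_def)
      then obtain v where "v \<in> lists X" "w = g v" by blast
      then show "w \<in> g ` N []" using w adj by (auto simp: N_def)
    qed
  qed
  have N0: "N [] = (\<lambda>x. [x]) ` X" by (auto simp: N_def tree_adj_def)
  have fin: "finite (N [])" using assms by (simp add: N0)
  have le: "card (N (g [])) \<le> card X"
    using card_image_le[OF fin, of g] card_image_le[OF assms(1), of "\<lambda>x. [x]"]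
    unfolding gN[symmetric] N0 by (rule le_trans)
  obtain w z where wz: "g [] = w @ [z]" using ne by (metis rev_exhaust)
  have gl: "g [] \<in> lists X" using b by (auto simp: bij_betw_def)
  then have "w \<in> lists X" "z \<in> X" using wz by auto
  then have "insert w ((\<lambda>x. g [] @ [x]) ` X) \<subseteq> N (g [])"
    using gl by (auto simp: N_def tree_adj_def wz)
  moreover have "finite (N (g []))" using fin gN by (metis finite_imageI)
  ultimately have "card (insert w ((\<lambda>x. g [] @ [x]) ` X)) \<le> card X"
    using le card_mono by (meson le_trans)
  moreover have "card ((\<lambda>x. g [] @ [x]) ` X) = card X"
    by (intro card_image) (auto simp: inj_on_def)
  moreover have "w \<notin> (\<lambda>x. g [] @ [x]) ` X" by (auto simp: wz)
  ultimately show False using assms by simp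
qed

lemma tree_auts_child:
  assumes X: "finite X" and g: "g \<in> tree_auts X" and "v \<in> lists X" "x \<in> X"
  shows "\<exists>y\<in>X. g (v @ [x]) = g v @ [y]"
  using assms(3,4)
proof (induction v arbitrary: x rule: rev_induct)
  case Nil
  then have "tree_adj X (g []) (g [x])" using g by (auto simp: tree_auts_def tree_adj_def)
  then show ?case using tree_auts_Nil[OF X g] by (auto simp: tree_adj_def)
next
  case (snoc z w)
  then have mem: "w \<in> lists X" "z \<in> X" "x \<in> X" by auto
  obtain y' where y': "g (w @ [z]) = g w @ [y']" using snoc.IH[OF mem(1,2)] by auto
  have "tree_adj X (w @ [z]) (w @ [z, x])"
    using mem by (auto simp: tree_adj_def)
  then have "tree_adj X (g (w @ [z])) (g (w @ [z, x]))"
    using g mem by (auto simp: tree_auts_def)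
  moreover have "g (w @ [z, x]) \<noteq> g w"
  proof
    assume "g (w @ [z, x]) = g w"
    moreover have "inj_on g (lists X)" using g by (auto simp: tree_auts_def Bij_def bij_betw_def)
    ultimately show False using mem by (auto dest!: inj_onD)
  qed
  ultimately show ?case by (auto simp: tree_adj_def y')
qed

lemma tree_auts_append:
  assumes X: "finite X" and g: "g \<in> tree_auts X" and u: "u \<in> lists X" and "v \<in> lists X"
  shows "\<exists>w\<in>lists X. g (u @ v) = g u @ w"
  using assms(4)
proof (induction v rule: rev_induct)
  case Nil
  then show ?case by auto
next
  case (snoc x v)
  then obtain w where w: "w \<in> lists X" "g (u @ v) = g u @ w" by auto
  obtain y where "y \<in> X" "g ((u @ v) @ [x]) = g (u @ v) @ [y]"
    using tree_auts_child[OF X g, of "u @ v" x] u snoc.prems by auto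
  then show ?case using w by (intro bexI[of _ "w @ [y]"]) auto
qed

lemma tree_section_ex1:
  assumes X: "finite X" and g: "g \<in> tree_auts X" and u: "u \<in> lists X"
  shows "\<exists>!h. h \<in> tree_auts X \<and> (\<forall>v\<in>lists X. g (u @ v) = g u @ h v)"
proof (rule ex_ex1I)
  define h where "h = (\<lambda>v\<in>lists X. drop (length (g u)) (g (u @ v)))"
  have h: "h v \<in> lists X" "g (u @ v) = g u @ h v" if "v \<in> lists X" for v
    using tree_auts_append[OF X g u that] that by (auto simp: h_def)
  have b: "bij_betw g (lists X) (lists X)" using g by (auto simp: tree_auts_def Bij_def)
  have "bij_betw h (lists X) (lists X)"
  proof (rule bij_betw_imageI)
    show "inj_on h (lists X)"
    proof (rule inj_onI)
      fix v w assume vw: "v \<in> lists X" "w \<in> lists X" "h v = h w"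
      then have "g (u @ v) = g (u @ w)" using h by metis
      moreover have "u @ v \<in> lists X" "u @ w \<in> lists X" using u vw by auto
      ultimately have "u @ v = u @ w" using b by (metis bij_betw_imp_inj_on inj_onD)
      then show "v = w" by simp
    qed
    show "h ` lists X = lists X"
    proof
      show "h ` lists X \<subseteq> lists X" using h by blast
      show "lists X \<subseteq> h ` lists X"
      proof
        fix w assume w: "w \<in> lists X"
        let ?k = "\<lambda>v\<in>lists X. inv_into (lists X) g v"
        have gu: "g u \<in> lists X" using b u by (auto simp: bij_betw_def)
        have gw: "g u @ w \<in> lists X" using gu w by auto
        obtain v where v: "v \<in> lists X" "?k (g u @ w) = ?k (g u) @ v"
          using tree_auts_append[OF X tree_auts_inv[OF g] gu w] by blast
        have "inv_into (lists X) g (g u @ w) = u @ v"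
          using v(2) gu gw b u by (simp add: bij_betw_def inv_into_f_f)
        then have "g (u @ v) = g u @ w"
          using b gw by (metis bij_betw_inv_into_right)
        then show "w \<in> h ` lists X" using h v(1) by force
      qed
    qed
  qed
  then have hB: "h \<in> Bij (lists X)" by (simp add: Bij_def h_def)
  have "tree_adj X (h v) (h w) \<longleftrightarrow> tree_adj X v w" if vw: "v \<in> lists X" "w \<in> lists X" for v w
  proof -
    have shift: "tree_adj X (a @ c) (a @ d) \<longleftrightarrow> tree_adj X c d" for a c d
      by (auto simp: tree_adj_def)
    have "tree_adj X (g (u @ v)) (g (u @ w)) \<longleftrightarrow> tree_adj X (u @ v) (u @ w)"
      using g u vw by (auto simp: tree_auts_def)
    then show ?thesis using h vw by (simp add: shift)
  qed
  with hB have "h \<in> tree_auts X" by (simp add: tree_auts_def)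
  then show "\<exists>h. h \<in> tree_auts X \<and> (\<forall>v\<in>lists X. g (u @ v) = g u @ h v)" using h by blast
next
  fix h k
  assume "h \<in> tree_auts X \<and> (\<forall>v\<in>lists X. g (u @ v) = g u @ h v)"
    and "k \<in> tree_auts X \<and> (\<forall>v\<in>lists X. g (u @ v) = g u @ k v)"
  then show "h = k"
    by (intro extensionalityI[of h "lists X" k]) (auto simp: tree_auts_def Bij_def)
qed

end

(* Fixing a letter x, self-similarity of a nontrivial finite p-group G on the p-adic tree amounts to
   a maximal subgroup M (the stabilizer of x) with a homomorphism phi : M -> G (the section at x)
   such that no nontrivial normal subgroup of G inside M is phi-invariant.

   Given phi and an abelian maximal subgroup, M must be abelian. If phi(M) is abelian, then M' is
   killed by phi. Otherwise the centre of phi(M) is central in G, which makes Z(G) invariant if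
   Z(G) <= M, while G = M Z(G) and M' = G' is invariant if not. Hence some z in M, central of order
   p, has phi(z) outside M, which gives the complement <phi(z)>, and the p-th powers of elements of
   M form an invariant subgroup, so M is elementary abelian.

   Conversely, if G = M<c> splits, let phi be 1 on a complement of S = Z(G) intersected with M in M, and let
   phi : S -> <c>S be such that iterating phi moves every nontrivial element of S out of M; every
   nontrivial normal subgroup of G inside M meets S. *)
theory Submission
  imports Defs "HOL-Algebra.Zassenhaus" "HOL-Algebra.Multiplicative_Group"
begin

section \<open>Groups of prime power order\<close>

text \<open>The prime enters by counting: an orbit of letters has p-power size at most
  \<open>p\<close>, so a letter that moves at all has orbit \<open>X\<close>, and its stabilizer has
  index \<open>p\<close>. Simplicity can only be played against subgroups normal in
  \<open>G\<close>, so each step of the forward direction exhibits such a subgroup of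
  \<open>M\<close> and asks whether \<phi> preserves it. The obstacle is that \<phi> maps into
  \<open>G\<close> and not into \<open>M\<close>. Control comes from factorizations: a subgroup not
  contained in a normal maximal subgroup \<open>N\<close> generates \<open>G\<close> together with
  \<open>N\<close>. With \<open>N = A\<close>, the given abelian maximal subgroup, this gives
  \<open>G = A \<phi>(M)\<close> when \<phi>(M) is not abelian; once \<open>M\<close> is abelian, it
  gives \<open>G = M \<phi>(M)\<close>. In the converse, \<open>c\<close> serves twice. Its powers
  are the coset representatives that label the letters. They also make room in the target: for
  \<open>B\<close> inside \<open>S\<close>, the group \<open>B<c>\<close> is larger than any image
  of \<open>B\<close> and meets \<open>M\<close> only in \<open>B\<close>, so a new generator can be
  sent to a value outside the image reached so far.\<close>

lemma (in group) group_action_restrict: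
  assumes closed: "\<And>g x. g \<in> carrier G \<Longrightarrow> x \<in> E \<Longrightarrow> a g x \<in> E"
    and one: "\<And>x. x \<in> E \<Longrightarrow> a \<one> x = x"
    and mult: "\<And>g h x. g \<in> carrier G \<Longrightarrow> h \<in> carrier G \<Longrightarrow> x \<in> E \<Longrightarrow> a (g \<otimes> h) x = a g (a h x)"
  shows "group_action G E (\<lambda>g. restrict (a g) E)"
proof -
  have bij: "restrict (a g) E \<in> Bij E" if g: "g \<in> carrier G" for g
  proof -
    have "bij_betw (a g) E E"
      by (rule bij_betw_byWitness[of _ "a (inv g)"])
        (use g in \<open>auto simp: closed one mult[symmetric]\<close>)
    then show ?thesis by (simp add: Bij_def)
  qed
  have "(\<lambda>g. restrict (a g) E) \<in> hom G (BijGroup E)"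
    using bij by (auto intro!: homI simp: BijGroup_def compose_def fun_eq_iff closed mult)
  then show ?thesis
    by (simp add: group_action_def group_hom_def group_hom_axioms_def group_axioms group_BijGroup)
qed

definition (in group) central :: "'a \<Rightarrow> bool" where
  "central z \<longleftrightarrow> z \<in> carrier G \<and> (\<forall>g\<in>carrier G. g \<otimes> z = z \<otimes> g)"

lemma (in group) centralizer_inv:
  assumes "g \<in> carrier G" "x \<in> carrier G" "g \<otimes> x = x \<otimes> g"
  shows "inv g \<otimes> x = x \<otimes> inv g"
proof -
  have "x = inv g \<otimes> (x \<otimes> g)" using assms by (simp add: m_assoc[symmetric] flip: assms(3))
  then have "x \<otimes> inv g = inv g \<otimes> (x \<otimes> g) \<otimes> inv g" by simp
  then show ?thesis using assms(1,2) by (simp add: m_assoc)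
qed

lemma (in group) subgroup_centralizer:
  assumes T: "T \<subseteq> carrier G"
  shows "subgroup {g \<in> carrier G. \<forall>x\<in>T. g \<otimes> x = x \<otimes> g} G"
proof (rule subgroupI)
  fix g h assume "g \<in> {g \<in> carrier G. \<forall>x\<in>T. g \<otimes> x = x \<otimes> g}"
    "h \<in> {g \<in> carrier G. \<forall>x\<in>T. g \<otimes> x = x \<otimes> g}"
  then have gh: "g \<in> carrier G" "h \<in> carrier G" "\<And>x. x \<in> T \<Longrightarrow> g \<otimes> x = x \<otimes> g"
    "\<And>x. x \<in> T \<Longrightarrow> h \<otimes> x = x \<otimes> h" by auto
  have "g \<otimes> h \<otimes> x = x \<otimes> (g \<otimes> h)" if x: "x \<in> T" for x
  proof -
    have xc: "x \<in> carrier G" using x T by auto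
    have "g \<otimes> h \<otimes> x = g \<otimes> (x \<otimes> h)" using gh x xc by (simp add: m_assoc)
    also have "\<dots> = x \<otimes> g \<otimes> h" using gh x xc by (simp add: m_assoc[symmetric])
    finally show ?thesis using gh xc by (simp add: m_assoc)
  qed
  then show "g \<otimes> h \<in> {g \<in> carrier G. \<forall>x\<in>T. g \<otimes> x = x \<otimes> g}" using gh by simp
next
  show "{g \<in> carrier G. \<forall>x\<in>T. g \<otimes> x = x \<otimes> g} \<noteq> {}"
    using T by (auto intro!: exI[of _ \<one>])
qed (use T in \<open>auto simp: centralizer_inv subset_iff\<close>)

lemma (in group) subgroup_central: "subgroup {z. central z} G"
proof -
  have "{z. central z} = {z \<in> carrier G. \<forall>g\<in>carrier G. z \<otimes> g = g \<otimes> z}"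
    by (auto simp: central_def)
  then show ?thesis using subgroup_centralizer[of "carrier G"] by simp
qed

lemma (in group) normal_central_subgroup:
  assumes "subgroup N G" "\<And>z. z \<in> N \<Longrightarrow> central z"
  shows "N \<lhd> G"
proof (rule normal_invI)
  fix x h assume xh: "x \<in> carrier G" "h \<in> N"
  then have "x \<otimes> h = h \<otimes> x" "h \<in> carrier G" using assms(2) by (auto simp: central_def)
  then show "x \<otimes> h \<otimes> inv x \<in> N" using xh by (simp add: m_assoc)
qed fact

lemma (in group) subgroup_nat_pow_mem:
  assumes "subgroup H G" "x \<in> H" shows "x [^] (n::nat) \<in> H"
  using assms by (induction n) (auto simp: subgroup.one_closed subgroup.m_closed)

text \<open>By Bezout \<open>i\<close> is invertible modulo \<open>p\<close>, so some power of
  \<open>b [^] i\<close> is \<open>b\<close> itself. Used in contrapositive form: if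
  \<open>b\<close> avoids a subgroup, so do all its nontrivial powers.\<close>

lemma (in group) mem_of_coprime_pow_mem:
  assumes H: "subgroup H G" and b: "b \<in> carrier G" and p: "prime p"
    and bp: "b [^] (p::nat) = \<one>" and i: "\<not> p dvd i" and bi: "b [^] (i::nat) \<in> H"
  shows "b \<in> H"
proof -
  have "coprime i p" using p i by (metis prime_imp_coprime coprime_commute)
  moreover have "i \<noteq> 0" using i by (metis dvd_0_right)
  ultimately obtain x y where xy: "i * x = p * y + 1" using bezout_nat[of i p] by auto
  have "b [^] (i * x) = b"
    unfolding xy using b bp by (simp add: nat_pow_mult[symmetric] nat_pow_pow[symmetric])
  then have "(b [^] i) [^] x = b" using b by (simp add: nat_pow_pow)
  then show ?thesis using subgroup_nat_pow_mem[OF H bi] by metis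
qed

text \<open>Normality of \<open>M\<close> makes \<open>M <#> K\<close> a subgroup; it properly
  contains \<open>M\<close>, so by maximality it is all of \<open>G\<close>.\<close>

lemma (in group) maximal_subgroup_mult:
  assumes M: "maximal_subgroup M G" "M \<lhd> G" and K: "subgroup K G" "\<not> K \<subseteq> M"
    and g: "g \<in> carrier G"
  obtains m k where "m \<in> M" "k \<in> K" "g = m \<otimes> k"
proof -
  have sM: "subgroup M G" using M(1) by (simp add: maximal_subgroup_def)
  have sMK: "subgroup (M <#> K) G" using mult_norm_subgroup[OF M(2) K(1)] .
  have "M \<subseteq> M <#> K"
  proof
    fix m assume "m \<in> M"
    then have "m = m \<otimes> \<one>" using sM by (simp add: subgroup.mem_carrier)
    then show "m \<in> M <#> K"
      unfolding set_mult_def using \<open>m \<in> M\<close> subgroup.one_closed[OF K(1)] by blast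
  qed
  moreover have "K \<subseteq> M <#> K"
  proof
    fix k assume "k \<in> K"
    then have "k = \<one> \<otimes> k" using K(1) by (simp add: subgroup.mem_carrier)
    then show "k \<in> M <#> K"
      unfolding set_mult_def using \<open>k \<in> K\<close> subgroup.one_closed[OF sM] by blast
  qed
  ultimately have "M <#> K = carrier G"
    using M(1) K(2) sMK unfolding maximal_subgroup_def by blast
  then show thesis using g that by (auto simp: set_mult_def)
qed

section \<open>Orbit counting: central elements and normality of maximal subgroups\<close>

locale prime_power_group = group G for G (structure) +
  fixes p n :: nat
  assumes p: "prime p" and order: "order G = p ^ n"
begin

lemma finite_carrier: "finite (carrier G)"
  using order p by (simp add: prime_gt_0_nat flip: order_gt_0_iff_finite)

lemma subgroup_prime_power:
  assumes "subgroup H G" shows "\<exists>k. card H = p ^ k"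
proof -
  have "card H dvd p ^ n" using lagrange[OF assms] order by (metis dvd_triv_right)
  then show ?thesis using p by (auto simp: divides_primepow_nat)
qed

text \<open>The moved points are a union of orbits with more than one element, each of size a power
  of \<open>p\<close>. Fixed points are later obtained as the complement, for conjugation on a
  normal subgroup and for translation of cosets.\<close>

lemma moved_points_dvd:
  assumes E: "finite E"
    and closed: "\<And>g x. g \<in> carrier G \<Longrightarrow> x \<in> E \<Longrightarrow> a g x \<in> E"
    and one: "\<And>x. x \<in> E \<Longrightarrow> a \<one> x = x"
    and mult: "\<And>g h x. g \<in> carrier G \<Longrightarrow> h \<in> carrier G \<Longrightarrow> x \<in> E \<Longrightarrow> a (g \<otimes> h) x = a g (a h x)"
  shows "p dvd card {x \<in> E. \<exists>g\<in>carrier G. a g x \<noteq> x}" (is "p dvd card ?N")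
proof -
  let ?a = "\<lambda>g. restrict (a g) E"
  interpret A: group_action G E ?a
    using closed one mult by (rule group_action_restrict)
  have sub: "orbit G ?a x \<subseteq> ?N" if x: "x \<in> ?N" for x
  proof
    fix y assume "y \<in> orbit G ?a x"
    then obtain g where g: "g \<in> carrier G" "y = a g x" using x by (auto simp: orbit_def)
    have y: "y \<in> E" using g x closed by auto
    show "y \<in> ?N"
    proof (rule ccontr)
      assume "y \<notin> ?N"
      then have fx: "\<And>h. h \<in> carrier G \<Longrightarrow> a h y = y" using y by auto
      have "x = a (inv g) y" using g x mult[of "inv g" g x] one by auto
      then have "x = y" using fx g by simp
      then show False using x fx by auto
    qed
  qed
  have fN: "finite ?N" using E by simp
  have div: "p dvd card (orbit G ?a x)" if x: "x \<in> ?N" for x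
  proof -
    have xE: "x \<in> E" using x by simp
    have "card (orbit G ?a x) dvd p ^ n"
      using A.orbit_stabilizer_theorem[OF xE] order by (metis dvd_triv_left)
    then obtain k where k: "card (orbit G ?a x) = p ^ k"
      using p by (auto simp: divides_primepow_nat)
    obtain g where g: "g \<in> carrier G" "a g x \<noteq> x" using x by auto
    have "x \<in> orbit G ?a x" "a g x \<in> orbit G ?a x"
      using A.orbit_refl[OF xE] g xE by (auto simp: orbit_def)
    moreover have "finite (orbit G ?a x)" using sub[OF x] fN finite_subset by blast
    ultimately have "card (orbit G ?a x) \<noteq> 1" using g by (metis card_1_singletonE singletonD)
    then have "k \<noteq> 0" using k by auto
    then show ?thesis using k by simp
  qed
  have U: "\<Union> (orbit G ?a ` ?N) = ?N"
    using sub A.orbit_refl by fastforce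
  have "p dvd card (\<Union> (orbit G ?a ` ?N))"
  proof (rule dvd_partition)
    show "finite (\<Union> (orbit G ?a ` ?N))" using fN by (simp only: U)
    show "\<forall>c\<in>orbit G ?a ` ?N. p dvd card c" using div by blast
    show "\<forall>c1\<in>orbit G ?a ` ?N. \<forall>c2\<in>orbit G ?a ` ?N. c1 \<noteq> c2 \<longrightarrow> c1 \<inter> c2 = {}"
      using A.disjoint_union by (auto simp: orbits_def)
  qed
  then show ?thesis by (simp only: U)
qed

lemma exists_order_p:
  assumes H: "subgroup H G" "H \<noteq> {\<one>}"
  obtains x where "x \<in> H" "x \<noteq> \<one>" "x [^] p = \<one>"
proof -
  obtain x where x: "x \<in> H" "x \<noteq> \<one>" using H subgroup.one_closed by blast
  then have xc: "x \<in> carrier G" using H by (auto simp: subgroup.mem_carrier)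
  obtain k where k: "ord x = p ^ k"
    using ord_dvd_group_order[OF xc] p by (auto simp: order divides_primepow_nat)
  have "k \<noteq> 0" using k x xc ord_eq_1 by (metis power_0)
  then obtain j where j: "k = Suc j" using not0_implies_Suc by blast
  have "x [^] (p ^ j) \<noteq> \<one>"
    using p by (auto simp: pow_eq_id[OF xc] k j dest!: dvd_imp_le)
  moreover have "(x [^] (p ^ j)) [^] p = \<one>"
    using xc k j by (simp add: nat_pow_pow pow_eq_id mult.commute)
  ultimately show thesis using that subgroup_nat_pow_mem[OF H(1) x(1)] by blast
qed

text \<open>For conjugation on \<open>N\<close> the fixed points are the central elements. Both
  \<open>card N\<close> and the number of moved points are divisible by \<open>p\<close>, hence so
  is the number of central elements of \<open>N\<close>, and \<one> cannot be the only one.\<close>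

lemma normal_meets_center:
  assumes N: "N \<lhd> G" "N \<noteq> {\<one>}"
  obtains z where "z \<in> N" "z \<noteq> \<one>" "z [^] p = \<one>" "central z"
proof -
  interpret N: normal N G by fact
  have fN: "finite N" using finite_carrier N.subset finite_subset by blast
  have "card N \<noteq> 1" using N(2) N.one_closed by (metis card_1_singletonE singletonD)
  then have pN: "p dvd card N"
    using subgroup_prime_power[OF N.subgroup_axioms] by (metis dvd_power gr0I power_0)
  let ?C = "{x \<in> N. central x}"
  let ?D = "{x \<in> N. \<exists>g\<in>carrier G. g \<otimes> x \<otimes> inv g \<noteq> x}"
  have "p dvd card ?D"
  proof (rule moved_points_dvd[OF fN])
    show "g \<otimes> x \<otimes> inv g \<in> N" if "g \<in> carrier G" "x \<in> N" for g x
      using that N(1) normal_inv_iff by blast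
  qed (auto simp: m_assoc inv_mult_group)
  moreover have CD: "?C = N - ?D"
    by (auto simp: central_def inv_solve_right' N.mem_carrier)
  ultimately have "p dvd card ?C"
    using pN fN by (simp add: CD card_Diff_subset dvd_diff_nat)
  then have "card ?C \<noteq> 1" using p by (metis not_prime_unit)
  moreover have sC: "subgroup ?C G"
    using subgroups_Inter_pair[OF N.subgroup_axioms subgroup_central] by (simp add: Int_def)
  ultimately have "?C \<noteq> {\<one>}" by (metis (no_types, lifting) card_1_singleton_iff One_nat_def)
  then show thesis using exists_order_p[OF sC] that by blast
qed

text \<open>Let \<open>M\<close> translate its own right cosets. Since \<open>p\<close> divides
  their number, the fixed coset \<open>M\<close> is not the only fixed one. A representative
  \<open>g\<close> of another fixed coset normalizes \<open>M\<close>, so the normalizer properly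
  contains \<open>M\<close> and equals \<open>G\<close>.\<close>

lemma maximal_subgroup_normal:
  assumes M: "maximal_subgroup M G"
  shows "M \<lhd> G"
proof -
  have sM: "subgroup M G" and MG: "M \<noteq> carrier G" using M by (auto simp: maximal_subgroup_def)
  interpret M: subgroup M G by fact
  obtain k where k: "card M = p ^ k" using subgroup_prime_power[OF sM] by blast
  interpret MM: prime_power_group "G\<lparr>carrier := M\<rparr>" p k
    using subgroup_imp_group[OF sM] p k
    by (simp add: prime_power_group_def prime_power_group_axioms_def order_def)
  have fM: "finite M" using finite_carrier M.subset finite_subset by blast
  have fin: "finite (rcosets M)" using finite_carrier by (simp add: RCOSETS_def)
  have "card (rcosets M) \<noteq> 1"
  proof
    assume "card (rcosets M) = 1"
    then have "card M = card (carrier G)" using lagrange[OF sM] by (simp add: order_def)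
    then show False using MG M.subset finite_carrier card_subset_eq by blast
  qed
  moreover have "card (rcosets M) dvd p ^ n" using lagrange[OF sM] order by (metis dvd_triv_left)
  ultimately have pR: "p dvd card (rcosets M)"
    using p divides_primepow_nat by (metis dvd_power gr0I power_0)
  let ?D = "{R \<in> rcosets M. \<exists>h\<in>M. R #> inv h \<noteq> R}"
  have "p dvd card {R \<in> rcosets M. \<exists>h\<in>carrier (G\<lparr>carrier := M\<rparr>). R #> inv h \<noteq> R}"
  proof (rule MM.moved_points_dvd[OF fin])
    show "R #> inv h \<in> rcosets M" if "h \<in> carrier (G\<lparr>carrier := M\<rparr>)" "R \<in> rcosets M" for h R
      using that by (auto simp: RCOSETS_def coset_mult_assoc M.subset)
    show "R #> inv \<one>\<^bsub>G\<lparr>carrier := M\<rparr>\<^esub> = R" if "R \<in> rcosets M" for R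
      using that by (auto simp: RCOSETS_def coset_mult_assoc M.subset)
    show "R #> inv (g \<otimes>\<^bsub>G\<lparr>carrier := M\<rparr>\<^esub> h) = R #> inv h #> inv g"
      if "g \<in> carrier (G\<lparr>carrier := M\<rparr>)" "h \<in> carrier (G\<lparr>carrier := M\<rparr>)" "R \<in> rcosets M" for g h R
      using that by (auto simp: RCOSETS_def coset_mult_assoc M.subset inv_mult_group m_assoc)
  qed
  then have "p dvd card ?D" by simp
  then have "p dvd card (rcosets M - ?D)"
    using pR fin by (simp add: card_Diff_subset dvd_diff_nat)
  then have "card (rcosets M - ?D) \<noteq> 1" using p by (metis not_prime_unit)
  moreover have "M \<in> rcosets M - ?D"
    using M.one_closed sM by (auto simp: RCOSETS_def coset_join2 intro!: bexI[of _ \<one>])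
  moreover have "rcosets M - ?D \<noteq> {M}"
    using \<open>card (rcosets M - ?D) \<noteq> 1\<close> by (metis card_1_singleton_iff One_nat_def)
  ultimately obtain R where R: "R \<in> rcosets M - ?D" "R \<noteq> M" by blast
  then obtain g where g: "g \<in> carrier G" "R = M #> g" by (auto simp: RCOSETS_def)
  have gM: "g \<notin> M" using R g coset_join2[OF g(1) sM] by auto
  have conj: "g \<otimes> h \<otimes> inv g \<in> M" if h: "h \<in> M" for h
  proof -
    have "R #> inv (inv h) = R" using R h by blast
    then have "M #> (g \<otimes> h) = M #> g" using g h by (simp add: coset_mult_assoc M.subset)
    then have "g \<otimes> h \<in> M #> g" using g h sM rcos_self[of "g \<otimes> h" M] by (metis M.mem_carrier m_closed)
    then obtain m where "m \<in> M" "g \<otimes> h = m \<otimes> g" by (auto simp: r_coset_def)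
    then show ?thesis using g h by (simp add: inv_solve_right' m_assoc)
  qed
  \<comment> \<open>The normalizer, written with equality rather than inclusion so that it is
    visibly closed under inverses. For \<open>g\<close> itself, finiteness of \<open>M\<close>
    upgrades inclusion to equality.\<close>
  let ?N = "{g \<in> carrier G. (\<lambda>h. g \<otimes> h \<otimes> inv g) ` M = M}"
  have comp: "(\<lambda>k. x \<otimes> y \<otimes> k \<otimes> inv (x \<otimes> y)) ` M = (\<lambda>h. x \<otimes> h \<otimes> inv x) ` (\<lambda>h. y \<otimes> h \<otimes> inv y) ` M"
    if "x \<in> carrier G" "y \<in> carrier G" for x y
    unfolding image_image using that
    by (intro image_cong) (auto simp: m_assoc inv_mult_group)
  have "subgroup ?N G"
  proof (rule subgroupI)
    show "?N \<noteq> {}" by (auto intro!: exI[of _ \<one>] simp: image_def)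
    fix x assume x: "x \<in> ?N"
    have "(\<lambda>h. inv x \<otimes> h \<otimes> inv (inv x)) ` (\<lambda>h. x \<otimes> h \<otimes> inv x) ` M = M"
      using x comp[of "inv x" x] by (auto simp: image_def)
    then show "inv x \<in> ?N" using x by simp
    fix y assume "y \<in> ?N"
    then show "x \<otimes> y \<in> ?N" using x comp[of x y] by simp
  qed auto
  moreover have "M \<subseteq> ?N"
  proof
    fix m assume m: "m \<in> M"
    have "h \<in> (\<lambda>h. m \<otimes> h \<otimes> inv m) ` M" if "h \<in> M" for h
      using m that by (intro image_eqI[of _ _ "inv m \<otimes> h \<otimes> m"]) (simp_all add: m_assoc, simp add: m_assoc[symmetric])
    then show "m \<in> ?N" using m by auto
  qed
  moreover have "g \<in> ?N"
  proof -
    have "inj_on (\<lambda>h. g \<otimes> h \<otimes> inv g) M" using g by (auto intro!: inj_onI)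
    then have "(\<lambda>h. g \<otimes> h \<otimes> inv g) ` M = M"
      using fM conj by (intro endo_inj_surj) auto
    then show ?thesis using g by simp
  qed
  ultimately have N: "?N = carrier G" using M gM unfolding maximal_subgroup_def by blast
  show ?thesis
  proof (rule normal_invI[OF sM])
    fix x h assume x: "x \<in> carrier G" and h: "h \<in> M"
    have "x \<in> ?N" using x N by blast
    then show "x \<otimes> h \<otimes> inv x \<in> M" using h by blast
  qed
qed

end

section \<open>Simple virtual endomorphisms\<close>

text \<open>The \<phi>-core is the largest \<phi>-invariant normal subgroup of \<open>G\<close>
  inside \<open>M\<close>; simplicity says that it is trivial. For the tree action built from \<phi>
  this is what yields faithfulness. As a function \<phi> is total, but only its values on
  \<open>M\<close> matter.\<close>

definition simple_virtual_endomorphism ::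
  "('a, 'b) monoid_scheme \<Rightarrow> 'a set \<Rightarrow> ('a \<Rightarrow> 'a) \<Rightarrow> bool" where
  "simple_virtual_endomorphism G M \<phi> \<longleftrightarrow> \<phi> \<in> hom (G\<lparr>carrier := M\<rparr>) G \<and>
     (\<forall>K. K \<lhd> G \<longrightarrow> K \<subseteq> M \<longrightarrow> \<phi> ` K \<subseteq> K \<longrightarrow> K = {\<one>\<^bsub>G\<^esub>})"

lemma (in group) derived_trivial_commute:
  assumes M: "subgroup M G" "derived G M = {\<one>}" and xy: "x \<in> M" "y \<in> M"
  shows "x \<otimes> y = y \<otimes> x"
proof -
  have c: "x \<in> carrier G" "y \<in> carrier G" using M xy by (auto simp: subgroup.mem_carrier)
  have "x \<otimes> y \<otimes> inv x \<otimes> inv y \<in> derived G M"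
    unfolding derived_def using xy by (intro generate.incl) blast
  then have "x \<otimes> y \<otimes> inv x \<otimes> inv y = \<one>" using M by simp
  then have "x \<otimes> y \<otimes> inv x = y" using c by (simp add: inv_solve_right')
  then show ?thesis using c by (simp add: inv_solve_right')
qed

lemma (in group) derived_trivial_if_commute:
  assumes M: "subgroup M G" and comm: "\<And>x y. x \<in> M \<Longrightarrow> y \<in> M \<Longrightarrow> x \<otimes> y = y \<otimes> x"
  shows "derived G M = {\<one>}"
proof -
  interpret M: comm_group "G\<lparr>carrier := M\<rparr>"
    using comm by (intro group.group_comm_groupI subgroup_imp_group M) auto
  show ?thesis using M.derived_eq_singleton[of M] derived_consistent[OF _ M, of M] by simp
qed

text \<open>Central factors cancel in commutators: \<open>[m z, m' z'] = [m, m']\<close>.\<close>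

lemma (in group) derived_mult_central:
  assumes M: "subgroup M G" and dec: "\<And>g. g \<in> carrier G \<Longrightarrow> \<exists>m\<in>M. \<exists>z. central z \<and> g = m \<otimes> z"
  shows "derived G (carrier G) = derived G M"
proof -
  have "derived_set G (carrier G) \<subseteq> derived_set G M"
  proof clarify
    fix g h assume "g \<in> carrier G" "h \<in> carrier G"
    then obtain m z m' z' where d: "m \<in> M" "central z" "g = m \<otimes> z" "m' \<in> M" "central z'" "h = m' \<otimes> z'"
      using dec by metis
    have c: "m \<in> carrier G" "m' \<in> carrier G" "z \<in> carrier G" "z' \<in> carrier G"
      using d M by (auto simp: subgroup.mem_carrier central_def)
    have z: "x \<otimes> z = z \<otimes> x" "x \<otimes> z' = z' \<otimes> x" if "x \<in> carrier G" for x
      using d that by (auto simp: central_def)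
    have gh: "g \<otimes> h = (m \<otimes> m') \<otimes> (z \<otimes> z')"
    proof -
      have "g \<otimes> h = m \<otimes> (z \<otimes> m') \<otimes> z'" unfolding d using c by (simp add: m_assoc)
      also have "\<dots> = m \<otimes> (m' \<otimes> z) \<otimes> z'" using z(1)[OF c(2)] by simp
      finally show ?thesis using c by (simp add: m_assoc)
    qed
    have hg: "h \<otimes> g = (m' \<otimes> m) \<otimes> (z \<otimes> z')"
    proof -
      have "h \<otimes> g = m' \<otimes> (z' \<otimes> m) \<otimes> z" unfolding d using c by (simp add: m_assoc)
      also have "\<dots> = m' \<otimes> (m \<otimes> z') \<otimes> z" using z(2)[OF c(1)] by simp
      also have "\<dots> = m' \<otimes> m \<otimes> (z' \<otimes> z)" using c by (simp add: m_assoc)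
      finally show ?thesis using z(2)[OF c(3)] by simp
    qed
    have "g \<otimes> h \<otimes> inv g \<otimes> inv h = (g \<otimes> h) \<otimes> inv (h \<otimes> g)"
      using \<open>g \<in> carrier G\<close> \<open>h \<in> carrier G\<close> by (simp add: inv_mult_group m_assoc)
    also have "\<dots> = (m \<otimes> m') \<otimes> inv (m' \<otimes> m)"
      unfolding gh hg inv_mult_group[OF m_closed[OF c(2,1)] m_closed[OF c(3,4)]]
      using c by (simp add: m_assoc) (simp add: m_assoc[symmetric])
    also have "\<dots> = m \<otimes> m' \<otimes> inv m \<otimes> inv m'"
      using c by (simp add: inv_mult_group m_assoc)
    finally show "g \<otimes> h \<otimes> inv g \<otimes> inv h \<in> derived_set G M" using d by auto
  qed
  then have "derived G (carrier G) \<subseteq> derived G M"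
    unfolding derived_def by (rule mono_generate)
  then show ?thesis using mono_derived[OF subgroup.subset[OF M]] by blast
qed

section \<open>From a simple virtual endomorphism to a splitting elementary abelian maximal
  subgroup\<close>

context prime_power_group
begin

text \<open>The complement is \<open><c>\<close>: a nontrivial power of \<open>c\<close> inside
  \<open>M\<close> would force \<open>c\<close> itself into \<open>M\<close>.\<close>

lemma splits_over_maximal:
  assumes M: "maximal_subgroup M G" and c: "c \<in> carrier G" "c \<notin> M" "c [^] p = \<one>"
  shows "splits_over G M"
proof -
  have sM: "subgroup M G" using M by (simp add: maximal_subgroup_def)
  have nM: "M \<lhd> G" using maximal_subgroup_normal[OF M] .
  let ?K = "generate G {c}"
  have K: "?K = {c [^] k | k::nat. True}"
    using generate_pow_on_finite_carrier[OF finite_carrier c(1)] by simp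
  have sK: "subgroup ?K G" using c by (intro generate_is_subgroup) simp
  have cK: "c \<in> ?K" by (simp add: generate.incl)
  have "M \<inter> ?K = {\<one>}"
  proof
    show "M \<inter> ?K \<subseteq> {\<one>}"
    proof
      fix x assume "x \<in> M \<inter> ?K"
      then obtain k :: nat where k: "x = c [^] k" "c [^] k \<in> M" unfolding K by auto
      then have "p dvd k" using mem_of_coprime_pow_mem[OF sM c(1) p c(3)] c(2) by blast
      then show "x \<in> {\<one>}" using k c by (auto simp: nat_pow_pow[symmetric] elim!: dvdE)
    qed
  qed (use sM sK in \<open>auto simp: subgroup.one_closed\<close>)
  moreover have "M <#> ?K = carrier G"
  proof
    show "carrier G \<subseteq> M <#> ?K"
    proof
      fix g assume g: "g \<in> carrier G"
      have "\<not> ?K \<subseteq> M" using cK c by blast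
      then obtain m k where "m \<in> M" "k \<in> ?K" "g = m \<otimes> k"
        using maximal_subgroup_mult[OF M nM sK _ g] by blast
      then show "g \<in> M <#> ?K" by (auto simp: set_mult_def)
    qed
    show "M <#> ?K \<subseteq> carrier G"
      using sM sK by (intro setmult_subset_G) (auto simp: subgroup.subset)
  qed
  ultimately show ?thesis unfolding splits_over_def using nM sK by blast
qed

text \<open>A nonabelian \<open>M\<close> has a nontrivial derived subgroup, which is normal in
  \<open>G\<close> and therefore not \<phi>-invariant. This failure of invariance is what each
  branch below contradicts, except the branch where the centre of \<open>G\<close> lies in
  \<open>M\<close> and is itself invariant.\<close>

lemma simple_virtual_endomorphism_comm:
  assumes M: "maximal_subgroup M G" and \<phi>: "simple_virtual_endomorphism G M \<phi>"
    and A: "maximal_subgroup A G" "comm_group (G\<lparr>carrier := A\<rparr>)"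
    and xy: "x \<in> M" "y \<in> M"
  shows "x \<otimes> y = y \<otimes> x"
proof (rule ccontr)
  assume neq: "x \<otimes> y \<noteq> y \<otimes> x"
  have sM: "subgroup M G" and sA: "subgroup A G" using M A by (auto simp: maximal_subgroup_def)
  have nM: "M \<lhd> G" and nA: "A \<lhd> G" using maximal_subgroup_normal M A by auto
  have simple: "K = {\<one>}" if "K \<lhd> G" "K \<subseteq> M" "\<phi> ` K \<subseteq> K" for K
    using \<phi> that by (auto simp: simple_virtual_endomorphism_def)
  have comA: "a \<otimes> b = b \<otimes> a" if "a \<in> A" "b \<in> A" for a b
    using comm_groupE(4)[OF A(2)] that by simp
  interpret f: group_hom "G\<lparr>carrier := M\<rparr>" G \<phi>
    using \<phi> subgroup_imp_group[OF sM]
    by (simp add: group_hom_def group_hom_axioms_def group_axioms simple_virtual_endomorphism_def)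
  have sI: "subgroup (\<phi> ` M) G" using f.img_is_subgroup by simp
  have hm: "\<phi> (u \<otimes> v) = \<phi> u \<otimes> \<phi> v" if "u \<in> M" "v \<in> M" for u v
    using f.hom_mult[of u v] that by simp
  have Ic: "\<phi> ` M \<subseteq> carrier G" using sI subgroup.subset by blast
  have img: "derived G (\<phi> ` M) = \<phi> ` derived G M"
    using f.derived_img[of M] derived_consistent[OF _ sM, of M] by simp
  have nD: "derived G M \<lhd> G" and DM: "derived G M \<subseteq> M"
    using derived_is_normal[OF nM] derived_incl[OF _ sM, of M] by auto
  have D: "\<not> \<phi> ` derived G M \<subseteq> derived G M"
    using simple[OF nD DM] derived_trivial_commute[OF sM _ xy] neq by blast
  \<comment> \<open>If the image were abelian, \<open>\<phi>(M') = \<phi>(M)'\<close> would be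
    trivial and hence contained in \<open>M'\<close>.\<close>
  have Inc: "\<exists>v\<in>\<phi> ` M. \<exists>w\<in>\<phi> ` M. v \<otimes> w \<noteq> w \<otimes> v"
  proof (rule ccontr)
    assume "\<not> ?thesis"
    then have "derived G (\<phi> ` M) = {\<one>}" by (intro derived_trivial_if_commute sI) blast
    then show False
      using D img subgroup.one_closed[OF normal_imp_subgroup[OF nD]] by simp
  qed
  then have IA: "\<not> \<phi> ` M \<subseteq> A" using comA by blast
  \<comment> \<open>Elements central in \<phi>(M) are central in \<open>G\<close>: such a
    \<open>u\<close> lies in \<open>A\<close>, so it commutes with both factors of
    \<open>G = A \<phi>(M)\<close>.\<close>
  have central_if: "central u" if u: "u \<in> \<phi> ` M" and comm: "\<And>v. v \<in> \<phi> ` M \<Longrightarrow> v \<otimes> u = u \<otimes> v" for u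
  proof -
    have uc: "u \<in> carrier G" using u Ic by blast
    let ?C = "\<lambda>v. {g \<in> carrier G. \<forall>x\<in>{v}. g \<otimes> x = x \<otimes> g}"
    have sC: "subgroup (?C v) G" if "v \<in> carrier G" for v
      using subgroup_centralizer[of "{v}"] that by simp
    \<comment> \<open>Otherwise \<open>G = A<u>\<close>, and every element of \<phi>(M) is an
      element of \<open>A\<close> times a power of \<open>u\<close>. Since \<open>u\<close> is
      central in \<phi>(M), this would make \<phi>(M) abelian.\<close>
    have uA: "u \<in> A"
    proof (rule ccontr)
      assume uA: "u \<notin> A"
      let ?K = "generate G {u}"
      have sK: "subgroup ?K G" "\<not> ?K \<subseteq> A"
        using uA uc generate_is_subgroup[of "{u}"] generate.incl[of u "{u}" G] by auto
      have dec: "\<exists>a\<in>A. \<exists>k\<in>?K. g = a \<otimes> k" if "g \<in> carrier G" for g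
        using maximal_subgroup_mult[OF A(1) nA sK that] by metis
      have K_sub: "?K \<subseteq> ?C v" if "v \<in> carrier G" "v \<otimes> u = u \<otimes> v" for v
        using that uc by (intro generate_subgroup_incl sC) auto
      have KI: "?K \<subseteq> \<phi> ` M" using u sI by (intro generate_subgroup_incl) auto
      have "v \<otimes> w = w \<otimes> v" if v: "v \<in> \<phi> ` M" and w: "w \<in> \<phi> ` M" for v w
      proof -
        have vc: "v \<in> carrier G" and wc: "w \<in> carrier G" using v w Ic by auto
        obtain a k where ak: "a \<in> A" "k \<in> ?K" "v = a \<otimes> k" using dec[OF vc] by blast
        obtain b l where bl: "b \<in> A" "l \<in> ?K" "w = b \<otimes> l" using dec[OF wc] by blast
        have c: "a \<in> carrier G" "b \<in> carrier G" using ak bl sA by (auto simp: subgroup.mem_carrier)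
        have lc: "l \<in> carrier G" "k \<in> carrier G" using sK bl ak by (auto simp: subgroup.mem_carrier)
        have bI: "b \<in> \<phi> ` M"
        proof -
          have "b = w \<otimes> inv l" using bl c lc by (simp add: m_assoc)
          moreover have "l \<in> \<phi> ` M" using KI bl by blast
          ultimately show ?thesis using sI w by (simp add: subgroup.m_closed subgroup.m_inv_closed)
        qed
        \<comment> \<open>Commutation is checked factor by factor in centralizers: \<open>b\<close>
          commutes with \<open>a\<close> inside \<open>A\<close>, and with \<open>k\<close>, a power
          of \<open>u\<close>, because \<open>b\<close> lies in \<phi>(M). So \<open>b\<close>
          commutes with \<open>v\<close>, as does \<open>l\<close>, and therefore so does
          \<open>w\<close>.\<close>
        have "a \<in> ?C b" using comA ak bl c by simp
        moreover have "k \<in> ?C b" using K_sub[OF c(2) comm[OF bI]] ak by blast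
        ultimately have "v \<in> ?C b" unfolding ak(3) by (rule subgroup.m_closed[OF sC[OF c(2)]])
        then have "b \<in> ?C v" using c by simp
        moreover have "l \<in> ?C v" using K_sub[OF vc comm[OF v]] bl by blast
        ultimately have "w \<in> ?C v" unfolding bl(3) by (rule subgroup.m_closed[OF sC[OF vc]])
        then show ?thesis by simp
      qed
      then show False using Inc by blast
    qed
    have "g \<otimes> u = u \<otimes> g" if g: "g \<in> carrier G" for g
    proof -
      obtain a k where ak: "a \<in> A" "k \<in> \<phi> ` M" "g = a \<otimes> k"
        using maximal_subgroup_mult[OF A(1) nA sI IA g] by metis
      have "a \<in> ?C u" using comA uA ak sA by (auto simp: subgroup.mem_carrier)
      moreover have "k \<in> ?C u" using comm ak Ic by auto
      ultimately have "g \<in> ?C u" unfolding ak(3) by (rule subgroup.m_closed[OF sC[OF uc]])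
      then show ?thesis by simp
    qed
    then show ?thesis using uc by (simp add: central_def)
  qed
  show False
  proof (cases "{z. central z} \<subseteq> M")
    case True
    \<comment> \<open>Images of central elements are central in \<phi>(M), hence in
      \<open>G\<close>. The centre would then be trivial, which is impossible in a nontrivial
      p-group.\<close>
    have "\<phi> ` {z. central z} \<subseteq> {z. central z}"
    proof clarify
      fix z assume z: "central z"
      then have zM: "z \<in> M" using True by blast
      show "central (\<phi> z)"
      proof (rule central_if)
        fix v assume "v \<in> \<phi> ` M"
        then obtain m where m: "m \<in> M" "v = \<phi> m" by blast
        have "m \<otimes> z = z \<otimes> m" using z m sM by (auto simp: central_def subgroup.mem_carrier)
        then show "v \<otimes> \<phi> z = \<phi> z \<otimes> v" using hm m zM by metis
      qed (use zM in simp)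
    qed
    then have "{z. central z} = {\<one>}"
      using True by (intro simple normal_central_subgroup subgroup_central) auto
    moreover have "carrier G \<noteq> {\<one>}"
      using sM M subgroup.one_closed subgroup.subset by (fastforce simp: maximal_subgroup_def)
    ultimately show False
      using normal_meets_center[of "carrier G"] subgroup_self normal_self by blast
  next
    case False
    \<comment> \<open>Here \<open>G\<close> is \<open>M\<close> times its centre, so
      \<open>G' = M'\<close>, and \<open>\<phi>(M') = \<phi>(M)'\<close> lies in \<open>G'\<close>:
      the derived subgroup of \<open>M\<close> is invariant after all.\<close>
    have "\<exists>m\<in>M. \<exists>z. central z \<and> g = m \<otimes> z" if "g \<in> carrier G" for g
      using maximal_subgroup_mult[OF M nM subgroup_central False that] by (metis mem_Collect_eq)
    then have "derived G (carrier G) = derived G M" by (rule derived_mult_central[OF sM])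
    then show False using D img mono_derived[OF Ic] by simp
  qed
qed

text \<open>With \<open>M\<close> and \<phi>(M) both abelian and \<open>G = M \<phi>(M)\<close>, the
  intersection of \<open>M\<close> and \<phi>(M) is central in \<open>G\<close>. This drives both
  the search for a complement and the invariance of the p-th powers.\<close>

theorem simple_virtual_endomorphism_imp_splits:
  assumes M: "maximal_subgroup M G" and \<phi>: "simple_virtual_endomorphism G M \<phi>"
    and A: "maximal_subgroup A G" "comm_group (G\<lparr>carrier := A\<rparr>)"
  shows "elementary_abelian p (G\<lparr>carrier := M\<rparr>) \<and> splits_over G M"
proof -
  have sM: "subgroup M G" and MG: "M \<noteq> carrier G" using M by (auto simp: maximal_subgroup_def)
  have nM: "M \<lhd> G" using maximal_subgroup_normal M by auto
  have Mc: "\<And>m. m \<in> M \<Longrightarrow> m \<in> carrier G" using sM by (simp add: subgroup.mem_carrier)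
  have simple: "K = {\<one>}" if "K \<lhd> G" "K \<subseteq> M" "\<phi> ` K \<subseteq> K" for K
    using \<phi> that by (auto simp: simple_virtual_endomorphism_def)
  have comm: "x \<otimes> y = y \<otimes> x" if "x \<in> M" "y \<in> M" for x y
    using simple_virtual_endomorphism_comm[OF M \<phi> A that] .
  have cM: "comm_group (G\<lparr>carrier := M\<rparr>)"
    using comm by (intro group.group_comm_groupI subgroup_imp_group sM) auto
  show ?thesis
  \<comment> \<open>For trivial \<open>M\<close> there is no central element to push through \<phi>;
    any element of order \<open>p\<close> generates a complement.\<close>
  proof (cases "M = {\<one>}")
    case True
    have "carrier G \<noteq> {\<one>}" using MG True by auto
    then obtain c where "c \<in> carrier G" "c \<noteq> \<one>" "c [^] p = \<one>"
      using exists_order_p[OF subgroup_self] by blast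
    then have "splits_over G M" using splits_over_maximal[OF M] True by blast
    moreover have "elementary_abelian p (G\<lparr>carrier := M\<rparr>)"
      using cM True by (simp add: elementary_abelian_def nat_pow_consistent[symmetric])
    ultimately show ?thesis by blast
  next
    case False
    interpret f: group_hom "G\<lparr>carrier := M\<rparr>" G \<phi>
      using \<phi> subgroup_imp_group[OF sM]
      by (simp add: group_hom_def group_hom_axioms_def group_axioms simple_virtual_endomorphism_def)
    have hm: "\<phi> (u \<otimes> v) = \<phi> u \<otimes> \<phi> v" if "u \<in> M" "v \<in> M" for u v
      using f.hom_mult[of u v] that by simp
    have hp: "\<phi> (u [^] k) = \<phi> u [^] k" if "u \<in> M" for u and k :: nat
      using f.hom_nat_pow[of u k] that by (simp add: nat_pow_consistent[symmetric])
    have sI: "subgroup (\<phi> ` M) G" using f.img_is_subgroup by simp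
    have Ic: "\<phi> ` M \<subseteq> carrier G" using sI subgroup.subset by blast
    have Icom: "v \<otimes> w = w \<otimes> v" if "v \<in> \<phi> ` M" "w \<in> \<phi> ` M" for v w
      using that comm hm by (metis imageE)
    \<comment> \<open>Otherwise \<open>M\<close> itself would be a nontrivial invariant normal
      subgroup.\<close>
    have IM: "\<not> \<phi> ` M \<subseteq> M" using simple[OF nM] False by blast
    have central_if: "central u" if u: "u \<in> \<phi> ` M" "u \<in> M" for u
    proof -
      have "g \<otimes> u = u \<otimes> g" if g: "g \<in> carrier G" for g
      proof -
        obtain m k where mk: "m \<in> M" "k \<in> \<phi> ` M" "g = m \<otimes> k"
          using maximal_subgroup_mult[OF M nM sI IM g] by metis
        have sC: "subgroup {g \<in> carrier G. \<forall>x\<in>{u}. g \<otimes> x = x \<otimes> g} G"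
          using u Mc by (intro subgroup_centralizer) auto
        have "m \<in> {g \<in> carrier G. \<forall>x\<in>{u}. g \<otimes> x = x \<otimes> g}" using mk u comm Mc by auto
        moreover have "k \<in> {g \<in> carrier G. \<forall>x\<in>{u}. g \<otimes> x = x \<otimes> g}" using mk u Icom Ic by auto
        ultimately show ?thesis unfolding mk(3) using subgroup.m_closed[OF sC] by blast
      qed
      then show ?thesis using u Mc by (simp add: central_def)
    qed
    \<comment> \<open>The elements of exponent \<open>p\<close> in the centre of \<open>G\<close>
      that lie in \<open>M\<close>. The exponent condition is what gives the escaping image
      \<open>\<phi> z\<close> a trivial p-th power.\<close>
    let ?Z = "{z \<in> M. central z \<and> z [^] p = \<one>}"
    have sZ: "subgroup ?Z G"
    proof (rule subgroupI)
      show "?Z \<noteq> {}"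
        using subgroup.one_closed[OF sM] subgroup.one_closed[OF subgroup_central] by auto
    next
      fix a assume "a \<in> ?Z"
      then show "inv a \<in> ?Z"
        using subgroup.m_inv_closed[OF sM] subgroup.m_inv_closed[OF subgroup_central, of a] Mc
        by (auto simp: nat_pow_inv)
    next
      fix a b assume ab: "a \<in> ?Z" "b \<in> ?Z"
      then have "(a \<otimes> b) [^] p = \<one>"
        using pow_mult_distrib[OF comm, of a b p] Mc by simp
      then show "a \<otimes> b \<in> ?Z"
        using ab subgroup.m_closed[OF sM] subgroup.m_closed[OF subgroup_central, of a b] by simp
    qed (use Mc in auto)
    have nZ: "?Z \<lhd> G" using sZ by (intro normal_central_subgroup) auto
    have "?Z \<noteq> {\<one>}" using normal_meets_center[OF nM False] by blast
    then have "\<not> \<phi> ` ?Z \<subseteq> ?Z" using simple[OF nZ] by blast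
    then obtain z where z: "z \<in> M" "central z" "z [^] p = \<one>" "\<phi> z \<notin> ?Z" by blast
    let ?c = "\<phi> z"
    have cI: "?c \<in> \<phi> ` M" using z by blast
    have cc: "?c \<in> carrier G" using cI Ic by blast
    have cp: "?c [^] p = \<one>" using hp[OF z(1), of p] z f.hom_one by simp
    \<comment> \<open>Were \<open>\<phi> z\<close> in \<open>M\<close>, it would lie in both
      \<open>M\<close> and \<phi>(M), so it would be central and belong to
      \<open>?Z\<close>.\<close>
    have cnM: "?c \<notin> M" using z cp central_if[OF cI] by blast
    have spl: "splits_over G M" using splits_over_maximal[OF M cc cnM cp] .
    let ?P = "(\<lambda>m. m [^] p) ` M"
    have PM: "?P \<subseteq> M" using subgroup_nat_pow_mem[OF sM] by blast
    have sP: "subgroup ?P G"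
    proof (rule subgroupI)
      show "?P \<noteq> {}" using subgroup.one_closed[OF sM] by blast
    next
      fix a assume "a \<in> ?P"
      then obtain m where "m \<in> M" "a = m [^] p" by blast
      then show "inv a \<in> ?P"
        using subgroup.m_inv_closed[OF sM] Mc by (intro image_eqI[of _ _ "inv m"]) (auto simp: nat_pow_inv)
    next
      fix a b assume "a \<in> ?P" "b \<in> ?P"
      then obtain m k where mk: "m \<in> M" "a = m [^] p" "k \<in> M" "b = k [^] p" by blast
      then have "a \<otimes> b = (m \<otimes> k) [^] p"
        using pow_mult_distrib[OF comm[OF mk(1,3)]] Mc by simp
      then show "a \<otimes> b \<in> ?P" using subgroup.m_closed[OF sM mk(1,3)] by blast
    qed (use Mc in auto)
    have nP: "?P \<lhd> G"
    proof (rule normal_invI[OF sP])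
      fix g a assume g: "g \<in> carrier G" and "a \<in> ?P"
      then obtain m where m: "m \<in> M" "a = m [^] p" by blast
      have conj: "g \<otimes> m [^] (k::nat) \<otimes> inv g = (g \<otimes> m \<otimes> inv g) [^] k" for k
      proof (induction k)
        case (Suc k)
        have "g \<otimes> m [^] Suc k \<otimes> inv g = (g \<otimes> m [^] k \<otimes> inv g) \<otimes> (g \<otimes> m \<otimes> inv g)"
          using g Mc[OF m(1)] by (simp add: m_assoc) (simp add: m_assoc[symmetric])
        then show ?case using Suc by simp
      qed (use g in simp)
      have "g \<otimes> m \<otimes> inv g \<in> M" using nM g m normal_inv_iff by blast
      then show "g \<otimes> a \<otimes> inv g \<in> ?P" unfolding m conj by blast
    qed
    \<comment> \<open>Write \<open>\<phi> m = x \<otimes> k\<close> with \<open>x\<close> in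
      \<open>M\<close> and \<open>k\<close> a power of \<open>?c\<close>. Both factors lie in the
      abelian group \<phi>(M), so the p-th power of \<open>\<phi> m\<close> is that of
      \<open>x\<close>.\<close>
    have "\<phi> ` ?P \<subseteq> ?P"
    proof
      fix b assume "b \<in> \<phi> ` ?P"
      then obtain m where m: "m \<in> M" "b = \<phi> m [^] p" using hp by auto
      let ?K = "generate G {?c}"
      have sK: "subgroup ?K G" using cc by (intro generate_is_subgroup) simp
      have K: "?K = {?c [^] k | k::nat. True}"
        using generate_pow_on_finite_carrier[OF finite_carrier cc] by simp
      have "\<phi> m \<in> carrier G" using m Ic by blast
      moreover have "\<not> ?K \<subseteq> M" using cnM generate.incl[of ?c "{?c}" G] by blast
      ultimately obtain x k where xk: "x \<in> M" "k \<in> ?K" "\<phi> m = x \<otimes> k"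
        using maximal_subgroup_mult[OF M nM sK] by metis
      have kI: "k \<in> \<phi> ` M" using xk(2) K subgroup_nat_pow_mem[OF sI cI] by auto
      have kc: "k \<in> carrier G" using kI Ic by blast
      obtain j :: nat where j: "k = ?c [^] j" using xk(2) K by auto
      have kp: "k [^] p = \<one>"
        unfolding j nat_pow_pow[OF cc] mult.commute[of j p] by (simp add: nat_pow_pow[OF cc, symmetric] cp)
      have "x = \<phi> m \<otimes> inv k" using xk kc Mc by (simp add: m_assoc)
      then have "x \<in> \<phi> ` M" using sI m kI by (simp add: subgroup.m_closed subgroup.m_inv_closed)
      then have "x \<otimes> k = k \<otimes> x" using Icom kI by blast
      then have "\<phi> m [^] p = x [^] p \<otimes> k [^] p"
        unfolding xk using Mc[OF xk(1)] kc by (intro pow_mult_distrib) auto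
      then have "b = x [^] p" using m kp Mc[OF xk(1)] by simp
      then show "b \<in> ?P" using xk by blast
    qed
    then have "?P = {\<one>}" using simple[OF nP PM] by blast
    then have "elementary_abelian p (G\<lparr>carrier := M\<rparr>)"
      using cM by (auto simp: elementary_abelian_def nat_pow_consistent[symmetric])
    then show ?thesis using spl by blast
  qed
qed

end

section \<open>Extending homomorphisms\<close>

lemma finite_maximal_subset:
  fixes P :: "'a set \<Rightarrow> bool"
  assumes "finite A" "P S" "\<And>B. P B \<Longrightarrow> B \<subseteq> A"
  obtains B where "P B" "\<And>B'. P B' \<Longrightarrow> B \<subseteq> B' \<Longrightarrow> B = B'"
proof -
  have "Collect P \<subseteq> Pow A" using assms(3) by blast
  then have "finite (Collect P)" using assms(1) by (simp add: finite_subset)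
  moreover have "Collect P \<noteq> {}" using assms(2) by blast
  ultimately obtain B where "B \<in> Collect P" "\<forall>B'\<in>Collect P. B \<subseteq> B' \<longrightarrow> B = B'"
    using finite_has_maximal by blast
  then show thesis using that by blast
qed

text \<open>The subgroup \<open>B<b>\<close> when \<open>b\<close> has finite order and commutes
  with \<open>B\<close>. Natural exponents suffice, since inverses of powers are again
  powers.\<close>

definition (in group) adjoin :: "'a set \<Rightarrow> 'a \<Rightarrow> 'a set" where
  "adjoin B b = {x \<otimes> b [^] i | x i::nat. x \<in> B}"

context group
begin

lemma adjoinI: "x \<in> B \<Longrightarrow> x \<otimes> b [^] (i::nat) \<in> adjoin B b"
  by (auto simp: adjoin_def)

lemma nat_pow_commute:
  assumes "x \<in> carrier G" "b \<in> carrier G" "x \<otimes> b = b \<otimes> x"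
  shows "b [^] (i::nat) \<otimes> x = x \<otimes> b [^] i"
proof (induction i)
  case (Suc i)
  have "b [^] Suc i \<otimes> x = b [^] i \<otimes> (b \<otimes> x)" using assms(1,2) by (simp add: m_assoc)
  also have "\<dots> = b [^] i \<otimes> x \<otimes> b" using assms(1,2) by (simp add: m_assoc flip: assms(3))
  also have "\<dots> = x \<otimes> b [^] i \<otimes> b" using Suc by simp
  finally show ?case using assms(1,2) by (simp add: m_assoc)
qed (use assms in simp)

lemma mult_adjoin:
  assumes "x \<in> carrier G" "y \<in> carrier G" "b \<in> carrier G" "y \<otimes> b = b \<otimes> y"
  shows "(x \<otimes> b [^] i) \<otimes> (y \<otimes> b [^] j) = (x \<otimes> y) \<otimes> b [^] (i + j :: nat)"
proof -
  have "(x \<otimes> b [^] i) \<otimes> (y \<otimes> b [^] j) = x \<otimes> (b [^] i \<otimes> y) \<otimes> b [^] j"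
    using assms by (simp add: m_assoc)
  also have "\<dots> = x \<otimes> (y \<otimes> b [^] i) \<otimes> b [^] j" using nat_pow_commute[OF assms(2-4)] by simp
  finally show ?thesis using assms by (simp add: m_assoc nat_pow_mult)
qed

lemma subgroup_adjoin:
  assumes B: "subgroup B G" and b: "b \<in> carrier G" "b [^] (p::nat) = \<one>" "p > 0"
    and comm: "\<And>x. x \<in> B \<Longrightarrow> x \<otimes> b = b \<otimes> x"
  shows "subgroup (adjoin B b) G"
proof (rule subgroupI)
  have Bc: "\<And>x. x \<in> B \<Longrightarrow> x \<in> carrier G" using B by (simp add: subgroup.mem_carrier)
  show "adjoin B b \<subseteq> carrier G" using Bc b by (auto simp: adjoin_def)
  show "adjoin B b \<noteq> {}" using subgroup.one_closed[OF B] by (auto simp: adjoin_def)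
  fix u assume "u \<in> adjoin B b"
  then obtain x and i :: nat where u: "x \<in> B" "u = x \<otimes> b [^] i" by (auto simp: adjoin_def)
  have x': "inv x \<in> B" using B u by (simp add: subgroup.m_inv_closed)
  \<comment> \<open>The exponent \<open>i * (p - 1)\<close> represents the inverse of
    \<open>b [^] i\<close>.\<close>
  have "i * (p - 1) + i = p * i" using b(3) by (simp add: algebra_simps)
  then have "(inv x \<otimes> b [^] (i * (p - 1))) \<otimes> u = \<one>"
    unfolding u mult_adjoin[OF Bc[OF x'] Bc[OF u(1)] b(1) comm[OF u(1)]]
    using Bc[OF u(1)] b by (simp add: nat_pow_pow[symmetric])
  then have "inv u = inv x \<otimes> b [^] (i * (p - 1))"
    using Bc[OF u(1)] b u by (intro inv_equality) auto
  then show "inv u \<in> adjoin B b" using adjoinI[OF x'] by simp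
  fix v assume "v \<in> adjoin B b"
  then obtain y and j :: nat where v: "y \<in> B" "v = y \<otimes> b [^] j" by (auto simp: adjoin_def)
  show "u \<otimes> v \<in> adjoin B b"
    unfolding u v mult_adjoin[OF Bc[OF u(1)] Bc[OF v(1)] b(1) comm[OF v(1)]]
    using B u v by (intro adjoinI) (simp add: subgroup.m_closed)
qed

lemma subset_adjoin:
  assumes B: "subgroup B G" and b: "b \<in> carrier G"
  shows "B \<subseteq> adjoin B b" "b \<in> adjoin B b"
proof
  fix x assume "x \<in> B"
  then show "x \<in> adjoin B b"
    using adjoinI[of x B b 0] subgroup.mem_carrier[OF B] by simp
next
  show "b \<in> adjoin B b" using adjoinI[OF subgroup.one_closed[OF B], of b 1] b by simp
qed

lemma adjoin_subset:
  assumes "subgroup S G" "B \<subseteq> S" "b \<in> S"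
  shows "adjoin B b \<subseteq> S"
  using assms subgroup_nat_pow_mem[OF assms(1,3)]
  by (auto simp: adjoin_def intro!: subgroup.m_closed)

text \<open>As \<open>b\<close> has order \<open>p\<close> and lies outside \<open>B\<close>, the
  product \<open>B<b>\<close> is direct. Any value \<open>a\<close> of exponent \<open>p\<close>
  that commutes with the image of \<open>f\<close> is therefore admissible for
  \<open>b\<close>.\<close>

lemma hom_extend_adjoin:
  assumes H: "group H" and B: "subgroup B G" and b: "b \<in> carrier G" "b \<notin> B"
    and p: "prime p" and bp: "b [^] (p::nat) = \<one>"
    and comm: "\<And>x. x \<in> B \<Longrightarrow> x \<otimes> b = b \<otimes> x"
    and f: "f \<in> hom (G\<lparr>carrier := B\<rparr>) H"
    and a: "a \<in> carrier H" "a [^]\<^bsub>H\<^esub> p = \<one>\<^bsub>H\<^esub>"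
    and fa: "\<And>x. x \<in> B \<Longrightarrow> f x \<otimes>\<^bsub>H\<^esub> a = a \<otimes>\<^bsub>H\<^esub> f x"
  obtains f' where "f' \<in> hom (G\<lparr>carrier := adjoin B b\<rparr>) H"
    "\<And>x i. x \<in> B \<Longrightarrow> f' (x \<otimes> b [^] (i::nat)) = f x \<otimes>\<^bsub>H\<^esub> a [^]\<^bsub>H\<^esub> i"
proof -
  interpret H: group H by fact
  have Bc: "\<And>x. x \<in> B \<Longrightarrow> x \<in> carrier G" using B by (simp add: subgroup.mem_carrier)
  have fc: "f x \<in> carrier H" if "x \<in> B" for x using f that by (auto simp: hom_def)
  have fm: "f (x \<otimes> y) = f x \<otimes>\<^bsub>H\<^esub> f y" if "x \<in> B" "y \<in> B" for x y
    using f that by (auto simp: hom_def)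
  \<comment> \<open>Two representations differ by a power \<open>b [^] d\<close> in
    \<open>B\<close>, so \<open>p\<close> divides \<open>d\<close>. The \<open>B\<close>-parts then
    agree, and so do the corresponding powers of \<open>a\<close>.\<close>
  have uniq_le: "x = y \<and> a [^]\<^bsub>H\<^esub> i = a [^]\<^bsub>H\<^esub> j"
    if e: "x \<otimes> b [^] i = y \<otimes> b [^] j" and x: "x \<in> B" and y: "y \<in> B" and ij: "i \<le> j" for x y and i j :: nat
  proof -
    obtain d where d: "j = d + i" using ij by (metis add.commute le_Suc_ex)
    have "x \<otimes> b [^] i = (y \<otimes> b [^] d) \<otimes> b [^] i"
      using e Bc[OF y] b unfolding d by (simp add: nat_pow_mult[symmetric] m_assoc)
    then have xd: "x = y \<otimes> b [^] d" using Bc[OF x] Bc[OF y] b by simp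
    then have "b [^] d = inv y \<otimes> x" using Bc[OF x] Bc[OF y] b by (simp add: m_assoc[symmetric])
    then have "b [^] d \<in> B" using B x y by (simp add: subgroup.m_closed subgroup.m_inv_closed)
    then have "p dvd d" using mem_of_coprime_pow_mem[OF B b(1) p bp] b(2) by blast
    then obtain e where "d = p * e" by blast
    then have "b [^] d = \<one>" "a [^]\<^bsub>H\<^esub> d = \<one>\<^bsub>H\<^esub>"
      using b a bp by (simp_all add: nat_pow_pow[symmetric] H.nat_pow_pow[symmetric])
    then show ?thesis using xd Bc[OF y] a by (simp add: d H.nat_pow_mult[symmetric])
  qed
  have uniq: "x = y \<and> a [^]\<^bsub>H\<^esub> i = a [^]\<^bsub>H\<^esub> j"
    if "x \<otimes> b [^] i = y \<otimes> b [^] j" "x \<in> B" "y \<in> B" for x y and i j :: nat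
    using uniq_le[of x i y j] uniq_le[of y j x i] that by (metis nle_le)
  define f' where "f' u = (THE v. \<exists>x\<in>B. \<exists>i::nat. u = x \<otimes> b [^] i \<and> v = f x \<otimes>\<^bsub>H\<^esub> a [^]\<^bsub>H\<^esub> i)" for u
  have f': "f' (x \<otimes> b [^] i) = f x \<otimes>\<^bsub>H\<^esub> a [^]\<^bsub>H\<^esub> i" if x: "x \<in> B" for x and i :: nat
    unfolding f'_def
  proof (rule the_equality)
    show "\<exists>y\<in>B. \<exists>j::nat. x \<otimes> b [^] i = y \<otimes> b [^] j \<and> f x \<otimes>\<^bsub>H\<^esub> a [^]\<^bsub>H\<^esub> i = f y \<otimes>\<^bsub>H\<^esub> a [^]\<^bsub>H\<^esub> j"
      using x by blast
    fix v assume "\<exists>y\<in>B. \<exists>j::nat. x \<otimes> b [^] i = y \<otimes> b [^] j \<and> v = f y \<otimes>\<^bsub>H\<^esub> a [^]\<^bsub>H\<^esub> j"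
    then show "v = f x \<otimes>\<^bsub>H\<^esub> a [^]\<^bsub>H\<^esub> i" using uniq x by metis
  qed
  have "f' \<in> hom (G\<lparr>carrier := adjoin B b\<rparr>) H"
  proof (rule homI; simp)
    fix u assume "u \<in> adjoin B b"
    then obtain x and i :: nat where u: "x \<in> B" "u = x \<otimes> b [^] i" by (auto simp: adjoin_def)
    show "f' u \<in> carrier H" using fc a u by (simp add: f')
    fix v assume "v \<in> adjoin B b"
    then obtain y and j :: nat where v: "y \<in> B" "v = y \<otimes> b [^] j" by (auto simp: adjoin_def)
    have xy: "x \<otimes> y \<in> B" using B u v by (simp add: subgroup.m_closed)
    show "f' (u \<otimes> v) = f' u \<otimes>\<^bsub>H\<^esub> f' v"
      unfolding u v mult_adjoin[OF Bc[OF u(1)] Bc[OF v(1)] b(1) comm[OF v(1)]]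
        f'[OF xy] f'[OF u(1)] f'[OF v(1)]
        H.mult_adjoin[OF fc[OF u(1)] fc[OF v(1)] a(1) fa[OF v(1)]]
        fm[OF u(1) v(1)] ..
  qed
  then show thesis using that f' by blast
qed

text \<open>A maximal extension is defined on all of \<open>M\<close>, because a missing generator
  can always be sent to the identity of \<open>H\<close>.\<close>

lemma hom_extend_elementary_abelian:
  assumes H: "group H" and M: "subgroup M G" "finite M" and p: "prime p"
    and pow: "\<And>x. x \<in> M \<Longrightarrow> x [^] (p::nat) = \<one>"
    and comm: "\<And>x y. x \<in> M \<Longrightarrow> y \<in> M \<Longrightarrow> x \<otimes> y = y \<otimes> x"
    and S: "subgroup S G" "S \<subseteq> M" and f: "f \<in> hom (G\<lparr>carrier := S\<rparr>) H"
  obtains g where "g \<in> hom (G\<lparr>carrier := M\<rparr>) H" "\<And>x. x \<in> S \<Longrightarrow> g x = f x"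
proof -
  interpret H: group H by fact
  let ?P = "\<lambda>B. subgroup B G \<and> S \<subseteq> B \<and> B \<subseteq> M \<and>
    (\<exists>g. g \<in> hom (G\<lparr>carrier := B\<rparr>) H \<and> (\<forall>x\<in>S. g x = f x))"
  have "?P S" using S f by auto
  then obtain B where PB: "?P B" and max: "\<And>B'. ?P B' \<Longrightarrow> B \<subseteq> B' \<Longrightarrow> B = B'"
    using finite_maximal_subset[of M ?P S] M(2) by blast
  then obtain g where B: "subgroup B G" "S \<subseteq> B" "B \<subseteq> M"
    and g: "g \<in> hom (G\<lparr>carrier := B\<rparr>) H" "\<And>x. x \<in> S \<Longrightarrow> g x = f x" by blast
  have gc: "g x \<in> carrier H" if "x \<in> B" for x using g that by (auto simp: hom_def)
  have "B = M"
  proof (rule ccontr)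
    assume "B \<noteq> M"
    then obtain b where b: "b \<in> M" "b \<notin> B" using B by blast
    have bc: "b \<in> carrier G" using M(1) b by (simp add: subgroup.mem_carrier)
    have bB: "\<And>x. x \<in> B \<Longrightarrow> x \<otimes> b = b \<otimes> x" using comm B b by blast
    obtain g' where g': "g' \<in> hom (G\<lparr>carrier := adjoin B b\<rparr>) H"
      "\<And>x i. x \<in> B \<Longrightarrow> g' (x \<otimes> b [^] (i::nat)) = g x \<otimes>\<^bsub>H\<^esub> \<one>\<^bsub>H\<^esub> [^]\<^bsub>H\<^esub> i"
      using hom_extend_adjoin[OF H B(1) bc b(2) p pow[OF b(1)] bB g(1) H.one_closed] gc by auto
    have "g' x = f x" if "x \<in> S" for x
      using g'(2)[of x 0] that B g gc[of x] subgroup.mem_carrier[OF B(1), of x] by auto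
    moreover have "subgroup (adjoin B b) G"
      using subgroup_adjoin[OF B(1) bc pow[OF b(1)] prime_gt_0_nat[OF p] bB] .
    moreover have "adjoin B b \<subseteq> M" using adjoin_subset[OF M(1) B(3) b(1)] .
    ultimately have "B = adjoin B b"
      using subset_adjoin[OF B(1) bc] B g'(1) by (intro max conjI) auto
    then show False using subset_adjoin[OF B(1) bc] b by blast
  qed
  then show thesis using that g by blast
qed

end

section \<open>From a splitting to a simple virtual endomorphism\<close>

context prime_power_group
begin

text \<open>The map \<open>f\<close> is built one generator of \<open>S\<close> at a time, by
  maximality of its domain \<open>B\<close>. The escape condition concerns arbitrary subsets
  \<open>K\<close> of \<open>M\<close>, so it can be passed from \<open>B\<close> to
  \<open>adjoin B b\<close> without checking that anything is a subgroup.\<close>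

lemma escaping_hom:
  assumes M: "subgroup M G" and c: "c \<in> carrier G" "c \<notin> M" "c [^] p = \<one>"
    and S: "subgroup S G" "S \<subseteq> M" and cent: "\<And>s. s \<in> S \<Longrightarrow> central s"
    and pow: "\<And>s. s \<in> S \<Longrightarrow> s [^] p = \<one>"
  shows "\<exists>f\<in>hom (G\<lparr>carrier := S\<rparr>) G. \<forall>K\<subseteq>M. f ` (K \<inter> S) \<subseteq> K \<longrightarrow> K \<inter> S \<subseteq> {\<one>}"
proof -
  have p0: "p > 0" using p by (rule prime_gt_0_nat)
  have finS: "finite S" using S(1) finite_carrier finite_subset subgroup.subset by blast
  have Sc: "\<And>x. x \<in> S \<Longrightarrow> x \<in> carrier G" using cent by (simp add: central_def)
  have Scomm: "x \<otimes> y = y \<otimes> x" if "x \<in> S" "y \<in> carrier G" for x y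
    using cent that by (simp add: central_def)
  define Q where "Q = (\<lambda>B f. f \<in> hom (G\<lparr>carrier := B\<rparr>) G \<and> f ` B \<subseteq> adjoin B c \<and>
    (\<forall>K. K \<subseteq> M \<longrightarrow> (\<forall>k\<in>K \<inter> B. f k \<in> K) \<longrightarrow> K \<inter> B \<subseteq> {\<one>}))"
  define P where "P B \<longleftrightarrow> subgroup B G \<and> B \<subseteq> S \<and> (\<exists>f. Q B f)" for B
  have "Q {\<one>} (\<lambda>x. \<one>)"
    unfolding Q_def
  proof (intro conjI allI impI)
    show "(\<lambda>x. \<one>) \<in> hom (G\<lparr>carrier := {\<one>}\<rparr>) G" by (rule homI) simp_all
    show "(\<lambda>x. \<one>) ` {\<one>} \<subseteq> adjoin {\<one>} c"
      using subset_adjoin(1)[OF triv_subgroup c(1)] by simp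
  qed blast
  then have "P {\<one>}" using triv_subgroup subgroup.one_closed[OF S(1)] by (auto simp: P_def)
  moreover have "\<And>B. P B \<Longrightarrow> B \<subseteq> S" by (simp add: P_def)
  ultimately obtain B where PB: "P B" and max: "\<And>B'. P B' \<Longrightarrow> B \<subseteq> B' \<Longrightarrow> B = B'"
    using finite_maximal_subset[OF finS, of P] by metis
  then obtain f where B: "subgroup B G" "B \<subseteq> S" and Qf: "Q B f" by (auto simp: P_def)
  have f: "f \<in> hom (G\<lparr>carrier := B\<rparr>) G" "f ` B \<subseteq> adjoin B c"
    using Qf unfolding Q_def by blast+
  have esc: "K \<inter> B \<subseteq> {\<one>}" if "K \<subseteq> M" "\<And>k. k \<in> K \<inter> B \<Longrightarrow> f k \<in> K" for K
    using Qf that(1) ballI[of "K \<inter> B" "\<lambda>k. f k \<in> K", OF that(2)] unfolding Q_def by simp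
  have "B = S"
  proof (rule ccontr)
    assume "B \<noteq> S"
    then obtain b where b: "b \<in> S" "b \<notin> B" using B by blast
    have bc: "b \<in> carrier G" using Sc b by blast
    let ?A = "adjoin B c"
    have sA: "subgroup ?A G"
      using B Scomm c by (intro subgroup_adjoin[OF B(1) c(1,3) p0]) auto
    have finA: "finite ?A" using sA finite_carrier finite_subset subgroup.subset by blast
    have Acom: "u \<otimes> v = v \<otimes> u" if u: "u \<in> ?A" and v: "v \<in> ?A" for u v
    proof -
      obtain x and i :: nat where x: "x \<in> B" "u = x \<otimes> c [^] i" using u by (auto simp: adjoin_def)
      obtain y and j :: nat where y: "y \<in> B" "v = y \<otimes> c [^] j" using v by (auto simp: adjoin_def)
      have S': "x \<in> S" "y \<in> S" using B x y by auto
      show ?thesis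
        unfolding x y mult_adjoin[OF Sc[OF S'(1)] Sc[OF S'(2)] c(1) Scomm[OF S'(2) c(1)]]
          mult_adjoin[OF Sc[OF S'(2)] Sc[OF S'(1)] c(1) Scomm[OF S'(1) c(1)]]
          Scomm[OF S'(1) Sc[OF S'(2)]] add.commute[of i j] ..
    qed
    have Apow: "u [^] p = \<one>" if u: "u \<in> ?A" for u
    proof -
      obtain x and i :: nat where x: "x \<in> B" "u = x \<otimes> c [^] i" using u by (auto simp: adjoin_def)
      then have xS: "x \<in> S" using B by auto
      have "u [^] p = x [^] p \<otimes> (c [^] i) [^] p"
        unfolding x using Sc[OF xS] c by (intro pow_mult_distrib Scomm[OF xS]) auto
      also have "(c [^] i) [^] p = (c [^] p) [^] i"
        unfolding nat_pow_pow[OF c(1)] by (simp add: mult.commute)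
      finally show ?thesis using pow[OF xS] c(3) by simp
    qed
    \<comment> \<open>Since \<open>B\<close> lies in \<open>M\<close>, an element
      \<open>x \<otimes> c [^] i\<close> of \<open>M\<close> has \<open>c [^] i\<close> in
      \<open>M\<close>, which forces that power to be trivial.\<close>
    have AM: "?A \<inter> M \<subseteq> B"
    proof
      fix u assume u: "u \<in> ?A \<inter> M"
      then obtain x and i :: nat where x: "x \<in> B" "u = x \<otimes> c [^] i" by (auto simp: adjoin_def)
      have xS: "x \<in> S" using x B by auto
      have "c [^] i = inv x \<otimes> u" using x Sc[OF xS] c by (simp add: m_assoc[symmetric])
      then have "c [^] i \<in> M" using xS S u M by (simp add: subgroup.m_closed subgroup.m_inv_closed subset_iff)
      then have "p dvd i" using mem_of_coprime_pow_mem[OF M c(1) p c(3)] c(2) by blast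
      then have "c [^] i = \<one>" using c by (auto simp: nat_pow_pow[symmetric] elim!: dvdE)
      then show "u \<in> B" using x Sc[OF xS] by simp
    qed
    have cA: "c \<in> ?A" "c \<notin> B" using subset_adjoin[OF B(1) c(1)] c B S by auto
    have "B \<subset> ?A" using cA subset_adjoin[OF B(1) c(1)] by blast
    then have "card B < card ?A" using finA by (simp add: psubset_card_mono)
    moreover have "card (f ` B) \<le> card B"
      using B finS finite_subset by (intro card_image_le) blast
    ultimately have "f ` B \<noteq> ?A" by auto
    \<comment> \<open>since \<open>f ` B\<close> is smaller than \<open>?A\<close>, we can send \<open>b\<close> to an element outside \<open>f ` B\<close>; then
      \<open>f' u\<close> is nontrivial for all \<open>u\<close> outside \<open>B\<close>\<close>
    then obtain a where a: "a \<in> ?A" "a \<notin> f ` B" using f by blast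
    have ac: "a \<in> carrier G" using a sA by (simp add: subgroup.mem_carrier)
    have bB: "\<And>x. x \<in> B \<Longrightarrow> x \<otimes> b = b \<otimes> x" using Scomm B bc by blast
    interpret f: group_hom "G\<lparr>carrier := B\<rparr>" G f
      using f subgroup_imp_group[OF B(1)]
      by (simp add: group_hom_def group_hom_axioms_def group_axioms)
    have sfB: "subgroup (f ` B) G" using f.img_is_subgroup by simp
    obtain f' where f': "f' \<in> hom (G\<lparr>carrier := adjoin B b\<rparr>) G"
      "\<And>x i. x \<in> B \<Longrightarrow> f' (x \<otimes> b [^] (i::nat)) = f x \<otimes> a [^] i"
      using hom_extend_adjoin[OF group_axioms B(1) bc b(2) p pow[OF b(1)] bB f(1) ac Apow[OF a(1)]]
        Acom[OF _ a(1)] f(2) by blast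
    have ff': "f' x = f x" if "x \<in> B" for x
      using f'(2)[OF that, of 0] that Sc B f.hom_closed[of x] by auto
    have f'A: "f' u \<in> ?A" if u: "u \<in> adjoin B b" for u
    proof -
      obtain x and i :: nat where x: "x \<in> B" "u = x \<otimes> b [^] i" using u by (auto simp: adjoin_def)
      have "f x \<in> ?A" using f x by blast
      then show ?thesis unfolding x(2) f'(2)[OF x(1)]
        using subgroup_nat_pow_mem[OF sA a(1)] by (rule subgroup.m_closed[OF sA])
    qed
    have "?A \<subseteq> adjoin (adjoin B b) c"
      using subset_adjoin[OF B(1) bc] unfolding adjoin_def[of _ c] by blast
    then have img: "f' ` adjoin B b \<subseteq> adjoin (adjoin B b) c" using f'A by blast
    have esc': "K \<inter> adjoin B b \<subseteq> {\<one>}"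
      if K: "K \<subseteq> M" "\<forall>k\<in>K \<inter> adjoin B b. f' k \<in> K" for K
    proof
      have KB: "K \<inter> B \<subseteq> {\<one>}"
        using K(2) subset_adjoin[OF B(1) bc] ff' by (intro esc[OF K(1)]) force
      fix u assume u: "u \<in> K \<inter> adjoin B b"
      then obtain x and i :: nat where x: "x \<in> B" "u = x \<otimes> b [^] i" by (auto simp: adjoin_def)
      show "u \<in> {\<one>}"
      proof (cases "u \<in> B")
        case True
        then show ?thesis using KB u by blast
      next
        case False
        have "\<not> p dvd i"
        proof
          assume "p dvd i"
          then have "b [^] i = \<one>" using bc pow[OF b(1)] by (auto simp: nat_pow_pow[symmetric] elim!: dvdE)
          then show False using False x B Sc by auto
        qed
        \<comment> \<open>The value \<open>f' u\<close> is in \<open>K\<close> and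
          \<open>?A\<close>, hence in \<open>K \<inter> B\<close>, which is trivial. So
          \<open>a [^] i\<close> would be an inverse of an element of \<open>f(B)\<close>, and
          \<open>a\<close> would lie in \<open>f(B)\<close>, against its choice.\<close>
        have "f' u \<in> K" using u K(2) by blast
        moreover have "f' u \<in> ?A" using f'A u by blast
        ultimately have "f' u \<in> K \<inter> B" using AM K(1) by blast
        then have "f x \<otimes> a [^] i = \<one>" using KB f'(2)[OF x(1)] x by auto
        moreover have "f x \<in> carrier G" using f.hom_closed[of x] x(1) by simp
        ultimately have "a [^] i = inv (f x)"
          using ac by (metis inv_equality inv_inv nat_pow_closed)
        then have "a [^] i \<in> f ` B" using sfB x by (simp add: subgroup.m_inv_closed)
        then have "a \<in> f ` B"
          using mem_of_coprime_pow_mem[OF sfB ac p Apow[OF a(1)] \<open>\<not> p dvd i\<close>] by blast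
        then show ?thesis using a by blast
      qed
    qed
    have "subgroup (adjoin B b) G"
      using subgroup_adjoin[OF B(1) bc pow[OF b(1)] p0 bB] .
    moreover have "adjoin B b \<subseteq> S" using adjoin_subset[OF S(1) B(2) b(1)] .
    ultimately have "P (adjoin B b)"
      unfolding P_def Q_def using f'(1) img esc' by (intro conjI exI[of _ f'] allI impI)
    then have "B = adjoin B b" using subset_adjoin[OF B(1) bc] by (intro max) auto
    then show False using subset_adjoin[OF B(1) bc] b by blast
  qed
  then show ?thesis using f(1) esc by (intro bexI[of _ f]) blast+
qed

text \<open>A complement of the proper subgroup \<open>M\<close> is nontrivial, so it contains an
  element of order \<open>p\<close>.\<close>

lemma splits_over_complement_element:
  assumes M: "maximal_subgroup M G" and "splits_over G M"
  obtains c where "c \<in> carrier G" "c \<notin> M" "c [^] p = \<one>"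
proof -
  obtain K where K: "subgroup K G" "M \<inter> K = {\<one>}" "M <#> K = carrier G"
    using assms(2) by (auto simp: splits_over_def)
  have sM: "subgroup M G" and MG: "M \<noteq> carrier G" using M by (auto simp: maximal_subgroup_def)
  have "K \<noteq> {\<one>}"
  proof
    assume "K = {\<one>}"
    then have "M <#> K = M" using sM by (force simp: set_mult_def subgroup.mem_carrier)
    then show False using K MG by simp
  qed
  then obtain c where "c \<in> K" "c \<noteq> \<one>" "c [^] p = \<one>" using exists_order_p[OF K(1)] by blast
  then show thesis using that[of c] K by (auto simp: subgroup.mem_carrier)
qed

theorem splits_imp_simple_virtual_endomorphism:
  assumes M: "maximal_subgroup M G" and el: "elementary_abelian p (G\<lparr>carrier := M\<rparr>)"
    and c: "c \<in> carrier G" "c \<notin> M" "c [^] p = \<one>"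
  shows "\<exists>\<phi>. simple_virtual_endomorphism G M \<phi>"
proof -
  have sM: "subgroup M G" using M by (auto simp: maximal_subgroup_def)
  have Mc: "\<And>m. m \<in> M \<Longrightarrow> m \<in> carrier G" using sM by (simp add: subgroup.mem_carrier)
  have finM: "finite M" using sM finite_carrier finite_subset subgroup.subset by blast
  have comm: "x \<otimes> y = y \<otimes> x" if "x \<in> M" "y \<in> M" for x y
    using el comm_groupE(4)[of "G\<lparr>carrier := M\<rparr>"] that by (simp add: elementary_abelian_def)
  have pow: "x [^] p = \<one>" if "x \<in> M" for x
    using el that by (simp add: elementary_abelian_def nat_pow_consistent[symmetric])
  let ?S = "M \<inter> {z. central z}"
  have sS: "subgroup ?S G" using subgroups_Inter_pair[OF sM subgroup_central] .
  have cent: "central s" and powS: "s [^] p = \<one>" if "s \<in> ?S" for s using pow that by auto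
  obtain f where f: "f \<in> hom (G\<lparr>carrier := ?S\<rparr>) G"
    and esc: "\<forall>K\<subseteq>M. f ` (K \<inter> ?S) \<subseteq> K \<longrightarrow> K \<inter> ?S \<subseteq> {\<one>}"
    using escaping_hom[OF sM c sS Int_lower1 cent powS] by blast
  obtain \<phi> where \<phi>: "\<phi> \<in> hom (G\<lparr>carrier := M\<rparr>) G" "\<And>x. x \<in> ?S \<Longrightarrow> \<phi> x = f x"
    using hom_extend_elementary_abelian[OF group_axioms sM finM p pow comm sS Int_lower1 f] by blast
  have "K = {\<one>}" if K: "K \<lhd> G" "K \<subseteq> M" "\<phi> ` K \<subseteq> K" for K
  proof (rule ccontr)
    assume "K \<noteq> {\<one>}"
    then obtain z where z: "z \<in> K" "z \<noteq> \<one>" "central z" using normal_meets_center[OF K(1)] by blast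
    have "f ` (K \<inter> ?S) \<subseteq> K" using K(3) \<phi>(2) by force
    then have "K \<inter> ?S \<subseteq> {\<one>}" using esc K(2) by blast
    then show False using z K by blast
  qed
  then show ?thesis using \<phi>(1) by (auto simp: simple_virtual_endomorphism_def)
qed

end

section \<open>Self-similar actions on the tree\<close>

lemma tree_auts_length:
  assumes "finite X" "g \<in> tree_auts X" "v \<in> lists X"
  shows "length (g v) = length v"
  using assms(3)
proof (induction v rule: rev_induct)
  case (snoc x v)
  then show ?case using tree_auts_child[OF assms(1,2), of v x] by auto
qed (use tree_auts_Nil[OF assms(1,2)] in simp)

lemma tree_auts_mem: "g \<in> tree_auts X \<Longrightarrow> v \<in> lists X \<Longrightarrow> g v \<in> lists X"
  by (auto simp: tree_auts_def Bij_def bij_betw_def)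

lemma Aut_tree_mult:
  assumes "g \<in> tree_auts X" "h \<in> tree_auts X" "v \<in> lists X"
  shows "(g \<otimes>\<^bsub>Aut_tree X\<^esub> h) v = g (h v)"
  using assms by (simp add: Aut_tree_def BijGroup_def tree_auts_def compose_eq)

lemma tree_section_apply:
  assumes "finite X" "g \<in> tree_auts X" "u \<in> lists X" "v \<in> lists X"
  shows "g (u @ v) = g u @ tree_section X g u v"
  using theI'[OF tree_section_ex1[OF assms(1-3)]] assms(4) unfolding tree_section_def by blast

lemma tree_section_eqI:
  assumes "finite X" "g \<in> tree_auts X" "u \<in> lists X" "h \<in> tree_auts X"
    and "\<And>v. v \<in> lists X \<Longrightarrow> g (u @ v) = g u @ h v"
  shows "tree_section X g u = h"
  unfolding tree_section_def using assms(4,5)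
  by (intro the1_equality tree_section_ex1[OF assms(1-3)]) blast

section \<open>The tree action defined by a virtual endomorphism and a coset transversal\<close>

locale self_similar_action = group G for G (structure) +
  fixes M :: "'a set" and \<phi> :: "'a \<Rightarrow> 'a" and X :: "'x set" and t :: "'x \<Rightarrow> 'a"
  assumes M: "subgroup M G" and \<phi>: "\<phi> \<in> hom (G\<lparr>carrier := M\<rparr>) G"
    and X: "finite X" and t: "x \<in> X \<Longrightarrow> t x \<in> carrier G"
    and transversal: "g \<in> carrier G \<Longrightarrow> \<exists>!y. y \<in> X \<and> inv (t y) \<otimes> g \<in> M"
begin

text \<open>Letters label the left cosets \<open>t y M\<close>, and \<open>g\<close> permutes them
  by left multiplication.\<close>

definition letter_act :: "'a \<Rightarrow> 'x \<Rightarrow> 'x" where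
  "letter_act g x = (THE y. y \<in> X \<and> inv (t y) \<otimes> (g \<otimes> t x) \<in> M)"

text \<open>With \<open>y = letter_act g x\<close>, the element \<open>g \<otimes> t x\<close> is
  \<open>t y\<close> times an element of \<open>M\<close>; applying \<phi> to that element gives the
  group element acting below \<open>x\<close>.\<close>

definition state :: "'a \<Rightarrow> 'x \<Rightarrow> 'a" where
  "state g x = \<phi> (inv (t (letter_act g x)) \<otimes> (g \<otimes> t x))"

primrec word_act :: "'a \<Rightarrow> 'x list \<Rightarrow> 'x list" where
  "word_act g [] = []"
| "word_act g (x # w) = letter_act g x # word_act (state g x) w"

primrec word_state :: "'a \<Rightarrow> 'x list \<Rightarrow> 'a" where
  "word_state g [] = g"
| "word_state g (x # w) = word_state (state g x) w"

lemma letter_act: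
  assumes "g \<in> carrier G" "x \<in> X"
  shows "letter_act g x \<in> X" "inv (t (letter_act g x)) \<otimes> (g \<otimes> t x) \<in> M"
  using theI'[OF transversal, of "g \<otimes> t x"] assms t unfolding letter_act_def by auto

lemma letter_act_eqI:
  assumes "g \<in> carrier G" "x \<in> X" "y \<in> X" "inv (t y) \<otimes> (g \<otimes> t x) \<in> M"
  shows "letter_act g x = y"
  using transversal[of "g \<otimes> t x"] letter_act[OF assms(1,2)] assms t by blast

lemma hom_closed: "m \<in> M \<Longrightarrow> \<phi> m \<in> carrier G"
  using \<phi> by (auto simp: hom_def)

lemma hom_mult: "m \<in> M \<Longrightarrow> k \<in> M \<Longrightarrow> \<phi> (m \<otimes> k) = \<phi> m \<otimes> \<phi> k"
  using \<phi> by (auto simp: hom_def)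

lemma state_closed: "g \<in> carrier G \<Longrightarrow> x \<in> X \<Longrightarrow> state g x \<in> carrier G"
  unfolding state_def using letter_act hom_closed by blast

text \<open>Inserting \<open>t ?y \<otimes> inv (t ?y)\<close> between \<open>g\<close> and
  \<open>h\<close> splits the \<open>M\<close>-part of the product into two elements of
  \<open>M\<close>, and \<phi> is multiplicative on these.\<close>

lemma
  assumes g: "g \<in> carrier G" and h: "h \<in> carrier G" and x: "x \<in> X"
  shows letter_act_mult: "letter_act (g \<otimes> h) x = letter_act g (letter_act h x)"
    and state_mult: "state (g \<otimes> h) x = state g (letter_act h x) \<otimes> state h x"
proof -
  let ?y = "letter_act h x"
  let ?z = "letter_act g ?y"
  have y: "?y \<in> X" "inv (t ?y) \<otimes> (h \<otimes> t x) \<in> M" using letter_act[OF h x] by auto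
  have z: "?z \<in> X" "inv (t ?z) \<otimes> (g \<otimes> t ?y) \<in> M" using letter_act[OF g y(1)] by auto
  have c: "t x \<in> carrier G" "t ?y \<in> carrier G" "t ?z \<in> carrier G" using t x y z by auto
  have eq: "inv (t ?z) \<otimes> ((g \<otimes> h) \<otimes> t x) =
    (inv (t ?z) \<otimes> (g \<otimes> t ?y)) \<otimes> (inv (t ?y) \<otimes> (h \<otimes> t x))"
    using g h c by (simp add: m_assoc) (simp add: m_assoc[symmetric])
  then have "inv (t ?z) \<otimes> ((g \<otimes> h) \<otimes> t x) \<in> M"
    using subgroup.m_closed[OF M z(2) y(2)] by simp
  then show l: "letter_act (g \<otimes> h) x = ?z"
    using g h x z by (intro letter_act_eqI) auto
  show "state (g \<otimes> h) x = state g ?y \<otimes> state h x"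
    unfolding state_def l eq by (rule hom_mult[OF z(2) y(2)])
qed

lemma letter_act_one: "x \<in> X \<Longrightarrow> letter_act \<one> x = x"
  using t subgroup.one_closed[OF M] by (intro letter_act_eqI) auto

lemma state_one: "x \<in> X \<Longrightarrow> state \<one> x = \<one>"
  using t hom_one[OF \<phi>] subgroup_imp_group[OF M] group_axioms
  by (simp add: state_def letter_act_one)

lemma word_act_closed: "g \<in> carrier G \<Longrightarrow> w \<in> lists X \<Longrightarrow> word_act g w \<in> lists X"
  by (induction w arbitrary: g) (auto simp: letter_act state_closed)

lemma word_act_mult:
  "g \<in> carrier G \<Longrightarrow> h \<in> carrier G \<Longrightarrow> w \<in> lists X \<Longrightarrow>
    word_act (g \<otimes> h) w = word_act g (word_act h w)"
  by (induction w arbitrary: g h) (auto simp: letter_act state_closed letter_act_mult state_mult)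

lemma word_act_one: "w \<in> lists X \<Longrightarrow> word_act \<one> w = w"
  by (induction w) (auto simp: letter_act_one state_one)

lemma word_state_closed: "g \<in> carrier G \<Longrightarrow> u \<in> lists X \<Longrightarrow> word_state g u \<in> carrier G"
  by (induction u arbitrary: g) (auto simp: state_closed)

lemma word_act_append: "word_act g (u @ v) = word_act g u @ word_act (word_state g u) v"
  by (induction u arbitrary: g) auto

lemma word_act_inv:
  assumes "g \<in> carrier G" "w \<in> lists X"
  shows "word_act (inv g) (word_act g w) = w"
  using word_act_mult[of "inv g" g w] assms by (simp add: word_act_one)

lemma word_act_adj:
  assumes "g \<in> carrier G" "u \<in> lists X" "v \<in> lists X" "tree_adj X u v"
  shows "tree_adj X (word_act g u) (word_act g v)"
proof -
  have "\<exists>y\<in>X. word_act g (w @ [x]) = word_act g w @ [y]" if "w \<in> lists X" "x \<in> X" for w x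
    using assms(1) that by (auto simp: word_act_append letter_act word_state_closed)
  then show ?thesis using assms by (fastforce simp: tree_adj_def)
qed

definition tree_act :: "'a \<Rightarrow> 'x list \<Rightarrow> 'x list" where
  "tree_act g = restrict (word_act g) (lists X)"

lemma tree_act_tree_auts:
  assumes g: "g \<in> carrier G"
  shows "tree_act g \<in> tree_auts X"
proof -
  have "bij_betw (word_act g) (lists X) (lists X)"
  proof (rule bij_betw_byWitness[of _ "word_act (inv g)"])
    show "word_act g ` lists X \<subseteq> lists X" "word_act (inv g) ` lists X \<subseteq> lists X"
      using word_act_closed g by blast+
  qed (use g word_act_inv[OF g] word_act_inv[of "inv g"] in \<open>simp_all del: in_lists_conv_set\<close>)
  moreover have "tree_adj X (word_act g u) (word_act g v) \<longleftrightarrow> tree_adj X u v"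
    if "u \<in> lists X" "v \<in> lists X" for u v
    using word_act_adj[OF g that] word_act_adj[of "inv g" "word_act g u" "word_act g v"]
      word_act_closed[OF g] word_act_inv[OF g] g that by auto
  ultimately show ?thesis
    by (simp add: tree_auts_def tree_act_def Bij_def del: in_lists_conv_set)
qed

lemma tree_act_hom: "tree_act \<in> hom G (Aut_tree X)"
proof (rule homI)
  fix g h assume gh: "g \<in> carrier G" "h \<in> carrier G"
  show "tree_act g \<in> carrier (Aut_tree X)"
    using tree_act_tree_auts[OF gh(1)] by (simp add: Aut_tree_def)
  have "tree_act (g \<otimes> h) v = compose (lists X) (tree_act g) (tree_act h) v" for v
    using gh by (simp add: tree_act_def compose_def word_act_mult word_act_closed del: in_lists_conv_set)
  then show "tree_act (g \<otimes> h) = tree_act g \<otimes>\<^bsub>Aut_tree X\<^esub> tree_act h"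
    using tree_act_tree_auts gh by (auto simp: Aut_tree_def BijGroup_def tree_auts_def)
qed

lemma tree_section_tree_act:
  assumes g: "g \<in> carrier G" and u: "u \<in> lists X"
  shows "tree_section X (tree_act g) u = tree_act (word_state g u)"
  using u word_state_closed[OF g u]
  by (intro tree_section_eqI X tree_act_tree_auts g)
    (auto simp: tree_act_def word_act_append simp del: in_lists_conv_set)

text \<open>The kernel of the tree action is a \<phi>-invariant normal subgroup inside
  \<open>M\<close>, so simplicity makes the action faithful.\<close>

lemma self_similar_if_simple:
  assumes simple: "simple_virtual_endomorphism G M \<phi>"
  shows "self_similar X G"
proof -
  interpret h: group_hom G "Aut_tree X" tree_act
    using tree_act_hom group_Aut_tree by (simp add: group_hom_def group_hom_axioms_def group_axioms)
  have one: "\<one>\<^bsub>Aut_tree X\<^esub> = (\<lambda>w\<in>lists X. w)" by (simp add: Aut_tree_def BijGroup_def)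
  let ?K = "kernel G (Aut_tree X) tree_act"
  have K: "g \<in> ?K \<longleftrightarrow> g \<in> carrier G \<and> (\<forall>w\<in>lists X. word_act g w = w)" for g
    unfolding kernel_def one tree_act_def by (auto simp: fun_eq_iff restrict_def)
  have nK: "?K \<lhd> G" by (rule h.normal_kernel)
  have conj: "t x \<otimes> k \<otimes> inv (t x) \<in> ?K" if "k \<in> ?K" "x \<in> X" for k x
    using nK that t normal_inv_iff by blast
  obtain x where x: "x \<in> X" using transversal[of \<one>] by auto
  \<comment> \<open>Since \<open>t x\<close> is arbitrary, the state of \<open>k\<close> itself at
    \<open>x\<close> need not be \<open>\<phi> k\<close>. Conjugation by \<open>t x\<close> keeps
    \<open>k\<close> in the kernel and cancels the representatives.\<close>
  have Kx: "k \<in> M \<and> state (t x \<otimes> k \<otimes> inv (t x)) x = \<phi> k" if k: "k \<in> ?K" for k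
  proof -
    let ?k = "t x \<otimes> k \<otimes> inv (t x)"
    have kc: "k \<in> carrier G" "?k \<in> carrier G" using k conj[OF k x] K by auto
    have "[x] \<in> lists X" using x by simp
    then have "word_act ?k [x] = [x]" using conj[OF k x] K[of ?k] by blast
    then have "letter_act ?k x = x" by simp
    moreover have "inv (t x) \<otimes> (?k \<otimes> t x) = k"
      using kc t[OF x] by (simp add: m_assoc) (simp add: m_assoc[symmetric])
    ultimately show ?thesis using letter_act(2)[OF kc(2) x] by (simp add: state_def)
  qed
  have "\<phi> ` ?K \<subseteq> ?K"
  proof clarify
    fix k assume k: "k \<in> ?K"
    let ?k = "t x \<otimes> k \<otimes> inv (t x)"
    have "word_act (state ?k x) w = w" if "w \<in> lists X" for w
      using conj[OF k x] K[of ?k] x that word_act.simps(2)[of ?k x w] by (metis Cons_in_lists_iff list.inject)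
    then show "\<phi> k \<in> ?K" using Kx[OF k] K hom_closed by auto
  qed
  then have "?K = {\<one>}"
    using simple nK Kx unfolding simple_virtual_endomorphism_def by blast
  then have inj: "inj_on tree_act (carrier G)" by (rule h.trivial_ker_imp_inj)
  let ?H = "tree_act ` carrier G"
  have "subgroup ?H (Aut_tree X)" by (rule h.img_is_subgroup)
  moreover have "tree_section X a u \<in> ?H" if "a \<in> ?H" "u \<in> lists X" for a u
  proof -
    from that(1) obtain g where g: "a = tree_act g" "g \<in> carrier G" by (rule imageE)
    show ?thesis unfolding g(1) tree_section_tree_act[OF g(2) that(2)]
      by (rule imageI[OF word_state_closed[OF g(2) that(2)]])
  qed
  ultimately have "self_similar_subgroup X ?H"
    unfolding self_similar_subgroup_def by blast
  moreover have "tree_act \<in> iso G ((Aut_tree X)\<lparr>carrier := ?H\<rparr>)"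
    using inj by (simp add: iso_def bij_betw_def hom_def)
  ultimately show ?thesis unfolding self_similar_def is_iso_def by blast
qed

end

section \<open>Passage between self-similarity and simple virtual endomorphisms for p-groups\<close>

context prime_power_group
begin

text \<open>The powers of \<open>c\<close> with exponents below \<open>p\<close> form a transversal
  of \<open>M\<close>; the bijection \<open>e\<close> attaches them to the letters.\<close>

lemma self_similar_if_splits:
  assumes X: "card X = p" and M: "maximal_subgroup M G"
    and c: "c \<in> carrier G" "c \<notin> M" "c [^] p = \<one>"
    and sve: "simple_virtual_endomorphism G M \<phi>"
  shows "self_similar X G"
proof -
  have p0: "p > 0" using p by (rule prime_gt_0_nat)
  have sM: "subgroup M G" using M by (simp add: maximal_subgroup_def)
  have nM: "M \<lhd> G" using maximal_subgroup_normal[OF M] .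
  have finX: "finite X" using X p0 card_gt_0_iff by metis
  obtain e where e: "bij_betw e X {0..<p}" using X finX ex_bij_betw_finite_nat by blast
  let ?t = "\<lambda>x. c [^] e x"
  have "\<exists>!y. y \<in> X \<and> inv (?t y) \<otimes> g \<in> M" if g: "g \<in> carrier G" for g
  proof (rule ex_ex1I)
    let ?K = "generate G {c}"
    have sK: "subgroup ?K G" using c by (intro generate_is_subgroup) simp
    have K: "?K = {c [^] k | k::nat. True}"
      using generate_pow_on_finite_carrier[OF finite_carrier c(1)] by simp
    have "\<not> ?K \<subseteq> M" using c generate.incl[of c "{c}" G] by blast
    then obtain m k where mk: "m \<in> M" "k \<in> ?K" "g = m \<otimes> k"
      using maximal_subgroup_mult[OF M nM sK _ g] by blast
    then obtain i :: nat where i: "k = c [^] i" unfolding K by auto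
    have "c [^] i = c [^] (i mod p)"
    proof -
      have "c [^] i = (c [^] p) [^] (i div p) \<otimes> c [^] (i mod p)"
        using c(1) by (simp add: nat_pow_pow nat_pow_mult)
      then show ?thesis using c by simp
    qed
    moreover obtain y where y: "y \<in> X" "e y = i mod p"
      using e p0 by (metis atLeast0LessThan bij_betw_iff_bijections lessThan_iff mod_less_divisor)
    ultimately have "inv (?t y) \<otimes> g = inv (?t y) \<otimes> m \<otimes> inv (inv (?t y))"
      using mk i c sM by (simp add: m_assoc subgroup.mem_carrier)
    moreover have "inv (?t y) \<in> carrier G" using c by simp
    then have "inv (?t y) \<otimes> m \<otimes> inv (inv (?t y)) \<in> M" using nM mk(1) normal_inv_iff by blast
    ultimately show "\<exists>y. y \<in> X \<and> inv (?t y) \<otimes> g \<in> M" using y by auto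
  next
    have le: "e y = e z" if "inv (?t y) \<otimes> g \<in> M" "inv (?t z) \<otimes> g \<in> M" "y \<in> X" "z \<in> X" "e z \<le> e y" for y z
    proof -
      have lt: "e y < p" using e that by (auto simp: bij_betw_def)
      obtain d where d: "e y = e z + d" using \<open>e z \<le> e y\<close> le_Suc_ex by blast
      \<comment> \<open>If two representatives share a coset, the power of \<open>c\<close> by the
        difference of their exponents lies in \<open>M\<close>; that difference is below
        \<open>p\<close>, so it is zero.\<close>
      have "(inv (?t z) \<otimes> g) \<otimes> inv (inv (?t y) \<otimes> g) = inv (?t z) \<otimes> ?t y"
        using c g by (simp add: inv_mult_group m_assoc) (simp add: m_assoc[symmetric])
      also have "\<dots> = c [^] d" unfolding d using c by (simp add: nat_pow_mult[symmetric] m_assoc[symmetric])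
      finally have "c [^] d \<in> M" using that(1,2) sM
        by (metis subgroup.m_closed subgroup.m_inv_closed)
      then have "p dvd d" using mem_of_coprime_pow_mem[OF sM c(1) p c(3)] c(2) by blast
      moreover have "d < p" using lt d by simp
      ultimately have "d = 0" using p0 by (metis dvd_imp_le gr0I not_le)
      then show ?thesis using d by simp
    qed
    fix y z assume "y \<in> X \<and> inv (?t y) \<otimes> g \<in> M" "z \<in> X \<and> inv (?t z) \<otimes> g \<in> M"
    then have "e y = e z" using le[of y z] le[of z y] by (metis nle_le)
    then show "y = z" using e \<open>y \<in> X \<and> _\<close> \<open>z \<in> X \<and> _\<close> by (auto simp: bij_betw_def dest: inj_onD)
  qed
  then interpret self_similar_action G M \<phi> X ?t
    using sve sM finX c unfolding simple_virtual_endomorphism_def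
    by (intro self_similar_action.intro self_similar_action_axioms.intro group_axioms) auto
  show ?thesis using self_similar_if_simple[OF sve] .
qed

text \<open>The pair consists of the stabilizer of a moved letter \<open>x\<close> and the section
  at \<open>x\<close>, pulled back to \<open>G\<close> along the isomorphism
  \<open>h\<close>.\<close>

lemma self_similar_imp_simple_virtual_endomorphism:
  assumes X: "card X = p" and ne: "carrier G \<noteq> {\<one>}" and ss: "self_similar X G"
  shows "\<exists>M \<phi>. maximal_subgroup M G \<and> simple_virtual_endomorphism G M \<phi>"
proof -
  obtain H where H: "self_similar_subgroup X H" and "G \<cong> (Aut_tree X)\<lparr>carrier := H\<rparr>"
    using ss by (auto simp: self_similar_def)
  then obtain h where h: "h \<in> iso G ((Aut_tree X)\<lparr>carrier := H\<rparr>)" by (auto simp: is_iso_def)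
  have p0: "p > 0" using p by (rule prime_gt_0_nat)
  have finX: "finite X" using X p0 card_gt_0_iff by metis
  have Haut: "H \<subseteq> tree_auts X"
    using H subgroup.subset by (fastforce simp: self_similar_subgroup_def Aut_tree_def)
  have bij: "bij_betw h (carrier G) H" using h by (simp add: iso_def)
  have hH: "h g \<in> H" if "g \<in> carrier G" for g using bij that by (auto simp: bij_betw_def)
  have aut: "h g \<in> tree_auts X" if "g \<in> carrier G" for g using hH Haut that by blast
  have mem: "h g v \<in> lists X" if "g \<in> carrier G" "v \<in> lists X" for g v
    using tree_auts_mem[OF aut] that by blast
  have mult: "h (g \<otimes> k) v = h g (h k v)" if "g \<in> carrier G" "k \<in> carrier G" "v \<in> lists X" for g k v
  proof -
    have "h (g \<otimes> k) = h g \<otimes>\<^bsub>Aut_tree X\<^esub> h k" using h that by (simp add: iso_def hom_def)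
    then show ?thesis using Aut_tree_mult[OF aut aut] that by simp
  qed
  have ext: "g = k" if "g \<in> carrier G" "k \<in> carrier G" "\<And>v. v \<in> lists X \<Longrightarrow> h g v = h k v" for g k
  proof -
    have "h g = h k"
      using aut that by (intro extensionalityI[of _ "lists X"]) (auto simp: tree_auts_def Bij_def)
    then show ?thesis using bij that by (auto simp: bij_betw_def dest: inj_onD)
  qed
  have one: "h \<one> v = v" if v: "v \<in> lists X" for v
  proof -
    have "h \<one> (h \<one> v) = h \<one> v" using mult[of \<one> \<one> v] v by simp
    moreover have "inj_on (h \<one>) (lists X)" using aut[OF one_closed] by (auto simp: tree_auts_def Bij_def bij_betw_def)
    ultimately show ?thesis using v mem[OF one_closed v] by (auto dest: inj_onD)
  qed
  let ?s = "\<lambda>g x. tree_section X (h g) [x]"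
  have sec: "h g (x # v) = h g [x] @ ?s g x v" if "g \<in> carrier G" "x \<in> X" "v \<in> lists X" for g x v
    using tree_section_apply[OF finX aut[OF that(1)], of "[x]" v] that by simp
  have secH: "?s g x \<in> H" if "g \<in> carrier G" "x \<in> X" for g x
    using H hH that by (auto simp: self_similar_subgroup_def)
  let ?E = "(\<lambda>x. [x]) ` X"
  have clE: "h g u \<in> ?E" if "g \<in> carrier G" "u \<in> ?E" for g u
    using tree_auts_child[OF finX aut[OF that(1)], of "[]"] tree_auts_Nil[OF finX aut[OF that(1)]] that by auto
  have actE: "group_action G ?E (\<lambda>g. restrict (h g) ?E)"
    using clE one mult by (intro group_action_restrict) auto
  have cardE: "card ?E = p" using X by (simp add: card_image inj_on_def)
  \<comment> \<open>If all letters were fixed, sections would fix them as well, since they lie in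
    \<open>H\<close> again. By induction on words the whole group would act trivially, although it
    is nontrivial.\<close>
  have "\<exists>x\<in>X. \<exists>g\<in>carrier G. h g [x] \<noteq> [x]"
  proof (rule ccontr)
    assume "\<not> ?thesis"
    then have triv: "h g [x] = [x]" if "g \<in> carrier G" "x \<in> X" for g x using that by blast
    have "h g v = v" if "v \<in> lists X" "g \<in> carrier G" for g v
      using that
    proof (induction v arbitrary: g rule: list.induct)
      case (Cons x v)
      then have xg: "x \<in> X" "v \<in> lists X" "g \<in> carrier G" by auto
      obtain k where k: "k \<in> carrier G" "h k = ?s g x"
        using secH[OF xg(3,1)] bij by (auto simp: bij_betw_def)
      then show ?case using sec[OF xg(3,1,2)] triv[OF xg(3,1)] Cons.IH[OF xg(2) k(1)] k(2) by simp
    qed (simp add: tree_auts_Nil[OF finX aut])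
    then have "g = \<one>" if "g \<in> carrier G" for g using ext[OF that one_closed] one that by simp
    then show False using ne one_closed by blast
  qed
  then obtain x where x: "x \<in> X" and mv: "\<exists>g\<in>carrier G. h g [x] \<noteq> [x]" by blast
  interpret A: group_action G ?E "\<lambda>g. restrict (h g) ?E" by (rule actE)
  let ?O = "orbit G (\<lambda>g. restrict (h g) ?E) [x]"
  let ?M = "{g \<in> carrier G. h g [x] = [x]}"
  have xE: "[x] \<in> ?E" using x by simp
  have stab: "stabilizer G (\<lambda>g. restrict (h g) ?E) [x] = ?M" using x by (auto simp: stabilizer_def)
  have sM: "subgroup ?M G" using A.stabilizer_subgroup[OF xE] by (simp only: stab)
  have orb: "card ?O * card ?M = p ^ n"
    using A.orbit_stabilizer_theorem[OF xE] order by (simp only: stab)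
  have OE: "?O \<subseteq> ?E" using clE xE by (auto simp: orbit_def)
  have finE: "finite ?E" using finX by simp
  have "card ?O dvd p ^ n" by (rule dvdI[OF orb[symmetric]])
  then obtain k where k: "card ?O = p ^ k" unfolding divides_primepow_nat[OF p] by blast
  \<comment> \<open>A power of \<open>p\<close> that is at most \<open>p\<close> and different from
    1.\<close>
  have cO: "card ?O = p"
  proof -
    have "card ?O \<le> p" using card_mono[OF finE OE] cardE by simp
    moreover have "card ?O \<noteq> 1"
    proof
      assume "card ?O = 1"
      then obtain u where u: "?O = {u}" by (rule card_1_singletonE)
      obtain g where g: "g \<in> carrier G" "h g [x] \<noteq> [x]" using mv by blast
      have "restrict (h g) ?E [x] \<in> ?O" unfolding orbit_def using g(1) by blast
      then have "h g [x] \<in> {u}" unfolding u using xE by (simp only: restrict_apply')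
      moreover have "[x] \<in> {u}" using A.orbit_refl[OF xE] unfolding u .
      ultimately show False using g(2) by simp
    qed
    then have "p \<le> card ?O" using k p0 by (cases k) auto
    ultimately show ?thesis by simp
  qed
  have OE: "?O = ?E" using card_subset_eq[OF finE OE] cO cardE by simp
  have trans: "\<exists>g\<in>carrier G. h g [x] = [y]" if "y \<in> X" for y
  proof -
    have "[y] \<in> ?O" using OE that by simp
    then show ?thesis using xE by (auto simp: orbit_def)
  qed
  have idx: "p * card ?M = p ^ n" using orb cO by simp
  \<comment> \<open>The stabilizer has index \<open>p\<close>, and orders of subgroups are powers of
    \<open>p\<close>, so none fits strictly between it and \<open>G\<close>.\<close>
  have maxM: "maximal_subgroup ?M G"
    unfolding maximal_subgroup_def
  proof (intro conjI allI impI sM)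
    show "?M \<noteq> carrier G" using mv by blast
    fix K assume sK: "subgroup K G" and MK: "?M \<subseteq> K"
    have finK: "finite K" using sK finite_carrier finite_subset subgroup.subset by blast
    obtain i where i: "card K = p ^ i" using subgroup_prime_power[OF sK] by blast
    obtain j where j: "card ?M = p ^ j" using subgroup_prime_power[OF sM] by blast
    have p1: "1 < p" using p by (rule prime_gt_1_nat)
    have "p ^ Suc j = p ^ n" using idx j by simp
    then have n: "n = Suc j" unfolding power_inject_exp[OF p1] by (rule sym)
    have "j \<le> i" using card_mono[OF finK MK] i j p1 by simp
    moreover have "card K dvd p ^ n" using lagrange[OF sK] order by (metis dvd_triv_right)
    then have "i \<le> n" using i p1 by (simp add: dvd_power_iff_le)
    ultimately consider "i = j" | "i = n" using n by linarith
    then show "K = ?M \<or> K = carrier G"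
    proof cases
      case 1
      then show ?thesis using card_subset_eq[OF finK MK] i j by simp
    next
      case 2
      then show ?thesis
        using card_subset_eq[OF finite_carrier subgroup.subset[OF sK]] i order by (simp add: order_def)
    qed
  qed
  let ?\<phi> = "\<lambda>m. inv_into (carrier G) h (?s m x)"
  have \<phi>c: "?\<phi> m \<in> carrier G" and h\<phi>: "h (?\<phi> m) = ?s m x" if "m \<in> carrier G" for m
    using secH[OF that x] bij by (auto simp: bij_betw_def inv_into_into f_inv_into_f)
  have Msec: "h m (x # v) = x # h (?\<phi> m) v" if "m \<in> ?M" "v \<in> lists X" for m v
    using sec[of m x v] that x h\<phi> by simp
  have "?\<phi> \<in> hom (G\<lparr>carrier := ?M\<rparr>) G"
  proof (rule homI)
    fix m k assume "m \<in> carrier (G\<lparr>carrier := ?M\<rparr>)" "k \<in> carrier (G\<lparr>carrier := ?M\<rparr>)"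
    then have mk: "m \<in> ?M" "k \<in> ?M" by auto
    then have c: "m \<in> carrier G" "k \<in> carrier G" by auto
    have mkM: "m \<otimes> k \<in> ?M" using subgroup.m_closed[OF sM mk] .
    show "?\<phi> m \<in> carrier G" using \<phi>c c by simp
    have "?\<phi> (m \<otimes> k) = ?\<phi> m \<otimes> ?\<phi> k"
    proof (rule ext)
      fix v assume v: "v \<in> lists X"
      have xv: "x # v \<in> lists X" using x v by simp
      have "x # h (?\<phi> (m \<otimes> k)) v = h m (h k (x # v))"
        using Msec[OF mkM v] mult[OF c xv] by simp
      also have "\<dots> = x # h (?\<phi> m) (h (?\<phi> k) v)"
        using Msec[OF mk(2) v] Msec[OF mk(1) mem[OF \<phi>c[OF c(2)] v]] by simp
      finally show "h (?\<phi> (m \<otimes> k)) v = h (?\<phi> m \<otimes> ?\<phi> k) v"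
        using mult[OF \<phi>c[OF c(1)] \<phi>c[OF c(2)] v] by simp
    qed (use \<phi>c c in auto)
    then show "?\<phi> (m \<otimes>\<^bsub>G\<lparr>carrier := ?M\<rparr>\<^esub> k) = ?\<phi> m \<otimes> ?\<phi> k" by simp
  qed
  moreover have "K = {\<one>}" if K: "K \<lhd> G" "K \<subseteq> ?M" "?\<phi> ` K \<subseteq> K" for K
  proof -
    have Kc: "\<And>k. k \<in> K \<Longrightarrow> k \<in> carrier G" using K by blast
    \<comment> \<open>To treat a word starting with any letter \<open>y\<close>, transitivity gives
      \<open>g\<close> carrying \<open>x\<close> to \<open>y\<close>. The conjugate of
      \<open>k\<close> by \<open>g\<close> stays in \<open>K\<close>, fixes \<open>x\<close>, and
      acts below \<open>x\<close> through its image under \<open>?\<phi>\<close>, again in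
      \<open>K\<close>. The tail \<open>w'\<close> differs from \<open>w\<close> but has the same
      length, hence induction on length.\<close>
    have "h k v = v" if "v \<in> lists X" "k \<in> K" for k v
      using that
    proof (induction "length v" arbitrary: v k rule: nat_induct)
      case 0
      then show ?case using tree_auts_Nil[OF finX aut] Kc by simp
    next
      case (Suc l)
      then obtain y w where v: "v = y # w" by (metis Suc_length_conv)
      have y: "y \<in> X" "w \<in> lists X" and k: "k \<in> carrier G" using Suc Kc v by auto
      obtain g where g: "g \<in> carrier G" "h g [x] = [y]" using trans[OF y(1)] by blast
      have gi: "inv g \<in> carrier G" using g by simp
      have "h (inv g) [y] = [x]" using mult[OF gi g(1), of "[x]"] g x one[of "[x]"] by simp
      then obtain w' where w': "w' \<in> lists X" "h (inv g) (y # w) = x # w'"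
        using tree_auts_append[OF finX aut[OF gi], of "[y]" w] y by auto
      have "length w' = length w"
        using tree_auts_length[OF finX aut[OF gi], of v] Suc.prems v w' by simp
      then have lw: "l = length w'" using Suc.hyps v by simp
      have gv: "h g (x # w') = v"
        using mult[OF g(1) gi, of v] g one[of v] Suc.prems w' v by simp
      have xw: "x # w' \<in> lists X" using x w' by simp
      let ?k = "inv g \<otimes> k \<otimes> g"
      have kK: "?k \<in> K" using K(1) gi Suc.prems(2) normal_inv_iff[of K] g by (metis inv_inv)
      then have kM: "?k \<in> ?M" using K(2) by blast
      have kc: "?k \<in> carrier G" using kM by blast
      have "h k v = h (g \<otimes> ?k) (x # w')"
      proof -
        have "g \<otimes> ?k = k \<otimes> g" using g k by (simp add: m_assoc[symmetric])
        then show ?thesis using mult[OF k g(1) xw] gv by simp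
      qed
      also have "\<dots> = h g (h ?k (x # w'))" by (rule mult[OF g(1) kc xw])
      also have "h ?k (x # w') = x # w'"
        using Msec[OF kM w'(1)] Suc.hyps(1)[OF lw w'(1), of "?\<phi> ?k"] kK K(3) by (simp add: image_subset_iff)
      finally show ?case using gv by simp
    qed
    then have "k = \<one>" if "k \<in> K" for k using ext[OF Kc[OF that] one_closed] one that by simp
    then show ?thesis using subgroup.one_closed[OF normal_imp_subgroup[OF K(1)]] by blast
  qed
  ultimately have "simple_virtual_endomorphism G ?M ?\<phi>"
    by (simp only: simple_virtual_endomorphism_def) blast
  then show ?thesis using maxM by blast
qed

end

theorem theorem2p2:
  fixes G :: "('a, 'b) monoid_scheme" and X :: "'x set" and p :: nat
  assumes "prime p"
    and "card X = p"
    and "finite_p_group p G"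
    and "\<exists>A. maximal_subgroup A G \<and> comm_group (G\<lparr>carrier := A\<rparr>)"
  shows "self_similar X G \<longleftrightarrow>
    (\<exists>M. maximal_subgroup M G \<and> elementary_abelian p (G\<lparr>carrier := M\<rparr>) \<and> splits_over G M)"
proof -
  obtain n where "group G" "order G = p ^ n" using assms(3) by (auto simp: finite_p_group_def)
  then interpret prime_power_group G p n
    using assms(1) by (simp add: prime_power_group_def prime_power_group_axioms_def)
  obtain A where A: "maximal_subgroup A G" "comm_group (G\<lparr>carrier := A\<rparr>)" using assms(4) by blast
  \<comment> \<open>The proper subgroup \<open>A\<close> shows that \<open>G\<close> is nontrivial,
    which is needed for some letter to move.\<close>
  have "subgroup A G" "A \<noteq> carrier G" using A(1) by (auto simp: maximal_subgroup_def)
  then have ne: "carrier G \<noteq> {\<one>\<^bsub>G\<^esub>}" using subgroup.one_closed subgroup.subset by fastforce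
  show ?thesis
  proof
    assume "self_similar X G"
    then obtain M \<phi> where M: "maximal_subgroup M G" "simple_virtual_endomorphism G M \<phi>"
      using self_similar_imp_simple_virtual_endomorphism[OF assms(2) ne] by blast
    then show "\<exists>M. maximal_subgroup M G \<and> elementary_abelian p (G\<lparr>carrier := M\<rparr>) \<and> splits_over G M"
      using simple_virtual_endomorphism_imp_splits[OF M A] by blast
  next
    assume "\<exists>M. maximal_subgroup M G \<and> elementary_abelian p (G\<lparr>carrier := M\<rparr>) \<and> splits_over G M"
    then obtain M where M: "maximal_subgroup M G" "elementary_abelian p (G\<lparr>carrier := M\<rparr>)"
      "splits_over G M" by blast
    obtain c where c: "c \<in> carrier G" "c \<notin> M" "c [^]\<^bsub>G\<^esub> p = \<one>\<^bsub>G\<^esub>"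
      using splits_over_complement_element[OF M(1,3)] by blast
    show "self_similar X G"
      using splits_imp_simple_virtual_endomorphism[OF M(1,2) c]
        self_similar_if_splits[OF assms(2) M(1) c] by blast
  qed
qed

end
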